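(* Let $r, d, m \ge 1$ be integers, let $\delta \ge 0$ be a real number, and let $u_1,\ldots,u_m\in \mathbb{C}^d$ be vectors such that $\sum_{i=1}^m u_i u_i^{*} \leq I_d$ and $\|u_i\|^2 \leq \delta$ for all $i\in\{1,\ldots,m\}$. Then there exists a partition $\{S_1,\ldots,S_r\}$ of $\{1,\ldots,m\}$ such that for all $k \in \{1,\ldots,r\}$, $$\Big\|\sum_{i\in S_k} u_i u_i^{*}\Big\| \leq \frac{1}{r}\left(1+\sqrt{r\delta}\right)^2.$$
   Context: For a column vector $u\in\mathbb{C}^d$, $u^{*}$ is its conjugate transpose and $\|u\|$ is the Euclidean norm. For a matrix, $\|\cdot\|$ is the operator (spectral) norm. $I_d$ is the $d\times d$ identity matrix. For Hermitian matrices, $A\le B$ means that $B-A$ is positive semidefinite. A partition $\{S_1,\ldots,S_r\}$ here means pairwise disjoint sets with union $\{1,\ldots,m\}$; some of the $S_k$ may be empty (an empty sum is the zero matrix). *)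

theory Defs
  imports "HOL-Analysis.Analysis"
begin

definition conj_transpose :: "complex^'n^'m \<Rightarrow> complex^'m^'n" where
  "conj_transpose A = (\<chi> i j. cnj (A $ j $ i))"

definition hermitian :: "complex^'n^'n \<Rightarrow> bool" where
  "hermitian A \<longleftrightarrow> conj_transpose A = A"

text \<open>The sum below is \<open>x\<^sup>* A x\<close>.\<close>

definition pos_semidef :: "complex^'n^'n \<Rightarrow> bool" where
  "pos_semidef A \<longleftrightarrow>
     hermitian A \<and> (\<forall>x. (\<Sum>i\<in>UNIV. cnj (x $ i) * (A *v x) $ i) \<in> \<real>\<^sub>\<ge>\<^sub>0)"

text \<open>Only meant for Hermitian arguments.  The pointwise order on vectors is a different relation.\<close>

definition loewner_le :: "complex^'n^'n \<Rightarrow> complex^'n^'n \<Rightarrow> bool" where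
  "loewner_le A B \<longleftrightarrow> pos_semidef (B - A)"

text \<open>The matrix \<open>u u\<^sup>*\<close>.\<close>

definition outer_self :: "complex^'n \<Rightarrow> complex^'n^'n" where
  "outer_self u = (\<chi> i j. u $ i * cnj (u $ j))"

text \<open>The library norm on \<open>complex^'n^'n\<close> is the Frobenius norm.  The spectral norm is the
  \<^const>\<open>onorm\<close> of the induced map, as the norm on \<open>complex^'n\<close> is Euclidean.\<close>

definition spectral_norm :: "complex^'n^'n \<Rightarrow> real" where
  "spectral_norm A = onorm (\<lambda>x. A *v x)"

end

theory Submission
  imports Defs "HOL-Complex_Analysis.Cauchy_Integral_Formula"
begin

text \<open>
  The proof follows Marcus, Spielman and Srivastava, but replaces polynomials and their roots by
  multi-affine functions and evaluations at real points.

  Put \<open>\<epsilon> = r \<delta>\<close>, \<open>R = (1 + \<surd>\<epsilon>)\<^sup>2\<close>, \<open>B = I - \<Sum> u\<^sub>i u\<^sub>i\<^sup>*\<close> and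
  \<open>g(z) = det (R B + \<Sum> z\<^sub>i u\<^sub>i u\<^sub>i\<^sup>*)\<close>. As the \<open>u\<^sub>i u\<^sub>i\<^sup>*\<close> have rank one, \<open>g\<close> is affine in each
  variable, and it has no zero with all \<open>z\<^sub>i\<close> in the upper half plane. Take \<open>r\<close> copies of the
  variables and let \<open>P(w) = \<Prod>\<^sub>k g(w(\<cdot>,k))\<close>. Putting the index \<open>i\<close> into the part \<open>S\<^sub>k\<close> amounts to
  lowering the single variable \<open>w(i,k)\<close> by \<open>r\<close>, since \<open>P\<close> evaluated with all variables equal to \<open>R\<close>
  before the lowering is then \<open>\<Prod>\<^sub>k det (R I - r \<Sum>\<^bsub>i\<in>S\<^sub>k\<^esub> u\<^sub>i u\<^sub>i\<^sup>*)\<close>. The average of the \<open>r\<close> possible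
  lowerings for \<open>i\<close> is, by affinity, the operator \<open>1 - \<Sum>\<^sub>k \<partial>\<^bsub>(i,k)\<^esub>\<close>. Say that a real point is above
  the zeros of a function if the function is positive on the whole orthant starting there.

  There are two halves. First, if the constant point \<open>R\<close> is above the zeros of the function obtained
  by averaging over all \<open>i\<close>, then it is above the zeros for some choice of one lowering per \<open>i\<close>
  (\<open>select_shifts\<close>). This is the role that interlacing families play in the original proof; here it
  comes from the fact that \<open>\<partial>\<^sub>a P / P\<close> decreases in every coordinate direction, which is immediate
  from stability: this quotient maps the upper half space to the lower half plane.

  Secondly, the constant point \<open>R\<close> is above the zeros of the averaged function
  (\<open>above_iterated_minus_partials\<close>). This is the barrier argument. One starts at the constant
  point \<open>\<surd>\<epsilon> + \<epsilon>\<close>, where each barrier \<open>\<Sum>\<^sub>k \<partial>\<^bsub>(i,k)\<^esub> P / P\<close> is at most \<open>1 - 1/(1 + \<surd>\<epsilon>)\<close>, and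
  moves the block of \<open>i\<close> by \<open>1 + \<surd>\<epsilon>\<close> each time the average over \<open>i\<close> is applied; the barriers never
  increase (\<open>barrier_step\<close>), because they are convex along such a move. Convexity is a statement on
  Nevanlinna functions that are holomorphic off a half line, and is deduced from the coefficient
  inequality for typically real functions on the disc (\<open>second_deriv_nonneg_slit\<close>).

  Finally, positivity of all determinants on the orthant above \<open>R\<close> bounds the quadratic forms of the
  sums over \<open>S\<^sub>k\<close> by \<open>R / r\<close> (\<open>form_le_of_nonsingular_ray\<close>), and thereby their norms.
\<close>

section \<open>Stable multi-affine functions\<close>

text \<open>For a function that is affine in the coordinate \<open>a\<close>, this difference is the partial derivative.\<close>

definition partial :: "'a \<Rightarrow> (('a \<Rightarrow> complex) \<Rightarrow> complex) \<Rightarrow> ('a \<Rightarrow> complex) \<Rightarrow> complex" where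
  "partial a P w = P (w(a := 1)) - P (w(a := 0))"

text \<open>The holomorphy clause asks for holomorphy along every complex line only, as this is what limits and
  complex analysis in one variable use, and it avoids a topology on the functions \<open>'a \<Rightarrow> complex\<close>.\<close>

definition real_multiaffine :: "(('a \<Rightarrow> complex) \<Rightarrow> complex) \<Rightarrow> bool" where
  "real_multiaffine P \<longleftrightarrow>
     (\<forall>w a x. P (w(a := x)) = P (w(a := 0)) + x * partial a P w) \<and>
     (\<forall>w. P (\<lambda>a. cnj (w a)) = cnj (P w)) \<and>
     (\<forall>w v. (\<lambda>t. P (\<lambda>a. w a + t * v a)) holomorphic_on UNIV)"

definition uhp_stable :: "(('a \<Rightarrow> complex) \<Rightarrow> complex) \<Rightarrow> bool" where
  "uhp_stable P \<longleftrightarrow> (\<forall>w. (\<forall>a. Im (w a) > 0) \<longrightarrow> P w \<noteq> 0)"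

text \<open>For a multi-affine \<open>P\<close> and a set \<open>K\<close> of \<open>r\<close> coordinates, this is the average over \<open>a \<in> K\<close> of the
  functions that arise from \<open>P\<close> by lowering the coordinate \<open>a\<close> by \<open>r\<close>.\<close>

definition one_minus_partials :: "'a set \<Rightarrow> (('a \<Rightarrow> complex) \<Rightarrow> complex) \<Rightarrow> ('a \<Rightarrow> complex) \<Rightarrow> complex" where
  "one_minus_partials K P w = P w - (\<Sum>a\<in>K. partial a P w)"

text \<open>The logarithmic derivative of \<open>P\<close> in the direction of the indicator function of \<open>K\<close>.\<close>

definition barrier :: "'a set \<Rightarrow> (('a \<Rightarrow> complex) \<Rightarrow> complex) \<Rightarrow> ('a \<Rightarrow> complex) \<Rightarrow> complex" where
  "barrier K P w = (\<Sum>a\<in>K. partial a P w) / P w"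

lemma affine_coord:
  assumes "real_multiaffine P"
  shows "P (w(a := x)) = P (w(a := 0)) + x * partial a P w"
  using assms[unfolded real_multiaffine_def, THEN conjunct1] by (elim allE)

lemma affine_step:
  assumes "real_multiaffine P"
  shows "P (w(a := w a + s)) = P w + s * partial a P w"
  using affine_coord[OF assms, of w a "w a + s"] affine_coord[OF assms, of w a "w a"]
  by (simp add: algebra_simps)

lemma multiaffine_cnj:
  assumes "real_multiaffine P"
  shows "P (\<lambda>a. cnj (w a)) = cnj (P w)"
  using assms[unfolded real_multiaffine_def, THEN conjunct2, THEN conjunct1] by (elim allE)

lemma multiaffine_holomorphic:
  assumes "real_multiaffine P"
  shows "(\<lambda>t. P (\<lambda>a. w a + t * v a)) holomorphic_on S"
  by (rule holomorphic_on_subset[OF _ subset_UNIV])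
    (rule assms[unfolded real_multiaffine_def, THEN conjunct2, THEN conjunct2, rule_format])

lemma multiaffine_real:
  assumes "real_multiaffine P" "\<And>a. Im (w a) = 0"
  shows "Im (P w) = 0"
proof -
  have "(\<lambda>a. cnj (w a)) = w" using assms(2) by (auto simp: complex_eq_iff)
  then have "cnj (P w) = P w" using multiaffine_cnj[OF assms(1), of w] by simp
  then show ?thesis by (simp add: complex_eq_iff)
qed

lemma partial_upd_same [simp]: "partial a P (w(a := x)) = partial a P w"
  by (simp add: partial_def)

lemma partial_commute:
  "partial a (partial b P) w = partial b (partial a P) w"
  by (cases "a = b") (auto simp: partial_def fun_upd_twist)

lemma real_multiaffine_partial:
  assumes "real_multiaffine P"
  shows "real_multiaffine (partial b P)"
  unfolding real_multiaffine_def
proof (intro conjI allI)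
  fix w a x
  show "partial b P (w(a := x)) = partial b P (w(a := 0)) + x * partial a (partial b P) w"
  proof (cases "a = b")
    case False
    then show ?thesis
      using affine_coord[OF assms, of "w(b:=1)" a x] affine_coord[OF assms, of "w(b:=0)" a x]
      by (simp add: partial_def fun_upd_twist algebra_simps)
  qed (simp add: partial_def)
next
  fix w :: "'a \<Rightarrow> complex"
  have "(\<lambda>a. cnj (w a))(b := 1) = (\<lambda>a. cnj ((w(b:=1)) a))"
       "(\<lambda>a. cnj (w a))(b := 0) = (\<lambda>a. cnj ((w(b:=0)) a))" by auto
  then show "partial b P (\<lambda>a. cnj (w a)) = cnj (partial b P w)"
    unfolding partial_def by (simp only: multiaffine_cnj[OF assms] complex_cnj_diff)
next
  fix w v :: "'a \<Rightarrow> complex"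
  have "(\<lambda>a. w a + t * v a)(b := x) = (\<lambda>a. (w(b:=x)) a + t * (v(b:=0)) a)" for t x by auto
  then show "(\<lambda>t. partial b P (\<lambda>a. w a + t * v a)) holomorphic_on UNIV"
    unfolding partial_def
    by (simp only:) (intro holomorphic_on_diff multiaffine_holomorphic[OF assms])
qed

lemma real_multiaffine_diff:
  assumes "real_multiaffine P" "real_multiaffine Q"
  shows "real_multiaffine (\<lambda>w. P w - Q w)"
  unfolding real_multiaffine_def
proof (intro conjI allI)
  fix w a x
  show "P (w(a := x)) - Q (w(a := x)) = P (w(a := 0)) - Q (w(a := 0))
      + x * partial a (\<lambda>w. P w - Q w) w"
    unfolding affine_coord[OF assms(1), of w a x] affine_coord[OF assms(2), of w a x]
    by (simp add: partial_def algebra_simps)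
qed (simp_all add: multiaffine_cnj assms holomorphic_on_diff multiaffine_holomorphic)

lemma real_multiaffine_sum:
  assumes "\<And>i. i \<in> K \<Longrightarrow> real_multiaffine (P i)"
  shows "real_multiaffine (\<lambda>w. \<Sum>i\<in>K. P i w)"
  unfolding real_multiaffine_def
proof (intro conjI allI)
  fix w a x
  have "(\<Sum>i\<in>K. P i (w(a := x))) = (\<Sum>i\<in>K. P i (w(a := 0)) + x * partial a (P i) w)"
    by (intro sum.cong refl affine_coord assms)
  also have "\<dots> = (\<Sum>i\<in>K. P i (w(a := 0))) + x * partial a (\<lambda>w. \<Sum>i\<in>K. P i w) w"
    by (simp add: partial_def sum.distrib sum_distrib_left sum_subtractf algebra_simps)
  finally show "(\<Sum>i\<in>K. P i (w(a := x))) = \<dots>" .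
qed (simp_all add: multiaffine_cnj assms holomorphic_on_sum multiaffine_holomorphic)

lemma real_multiaffine_one_minus_partials:
  assumes "real_multiaffine P"
  shows "real_multiaffine (one_minus_partials K P)"
proof -
  have "one_minus_partials K P = (\<lambda>w. P w - (\<Sum>a\<in>K. partial a P w))"
    by (auto simp: one_minus_partials_def)
  then show ?thesis
    by (simp add: real_multiaffine_diff real_multiaffine_sum real_multiaffine_partial assms)
qed

lemma Im_inverse_neg:
  assumes "Im q > 0"
  shows "Im (inverse q) < 0"
proof -
  have "(Re q)\<^sup>2 + (Im q)\<^sup>2 > 0" using assms by (simp add: sum_power2_gt_zero_iff)
  then show ?thesis using assms by (simp add: divide_neg_pos)
qed

text \<open>In the single variable \<open>w\<^sub>a\<close> the function \<open>P\<close> is affine, with its root in the closed lower half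
  plane at \<open>w\<^sub>a - q\<close> for \<open>q = P / \<partial>\<^sub>a P\<close>. Hence \<open>q\<close> is in the upper half plane.\<close>

lemma Im_partial_quotient_neg:
  assumes P: "real_multiaffine P" "uhp_stable P" and w: "\<forall>a. Im (w a) > 0"
    and B: "partial a P w \<noteq> 0"
  shows "Im (partial a P w / P w) < 0"
proof (rule ccontr)
  define q where "q = P w / partial a P w"
  assume "\<not> ?thesis"
  then have "Im (inverse q) \<ge> 0" by (simp add: q_def del: inverse_complex.sel)
  then have im: "Im q \<le> 0"
    using Im_inverse_neg[of q] by linarith
  define v where "v = w(a := w a + - q)"
  have "P v = P w + (- q) * partial a P w"
    unfolding v_def by (rule affine_step[OF P(1)])
  then have "P v = 0" using B by (simp add: q_def)
  moreover have "\<forall>b. Im (v b) > 0"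
    using w im by (auto simp: v_def intro: order_le_less_trans[OF im])
  ultimately show False using P(2) unfolding uhp_stable_def by blast
qed

lemma Im_partial_quotient_nonpos:
  assumes P: "real_multiaffine P" "uhp_stable P" and w: "\<forall>a. Im (w a) > 0"
  shows "Im (partial a P w / P w) \<le> 0"
proof (cases "partial a P w = 0")
  case False
  then show ?thesis using Im_partial_quotient_neg[OF P w False] by simp
qed simp

lemma barrier_sum: "barrier K P w = (\<Sum>a\<in>K. partial a P w / P w)"
  by (simp add: barrier_def sum_divide_distrib)

text \<open>A zero would give \<open>\<Sum> \<partial>\<^sub>a P / P = 1\<close>, but all summands have imaginary part \<open>\<le> 0\<close>, with equality
  only for those that vanish.\<close>

lemma stable_one_minus_partials:
  assumes P: "real_multiaffine P" "uhp_stable P"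
  shows "uhp_stable (one_minus_partials K P)"
  unfolding uhp_stable_def
proof (intro allI impI)
  fix w :: "'a \<Rightarrow> complex" assume w: "\<forall>a. Im (w a) > 0"
  have p: "P w \<noteq> 0" using P(2) w unfolding uhp_stable_def by blast
  show "one_minus_partials K P w \<noteq> 0"
  proof
    assume "one_minus_partials K P w = 0"
    then have one: "(\<Sum>a\<in>K. partial a P w / P w) = 1"
      using p by (simp add: one_minus_partials_def sum_divide_distrib[symmetric])
    have le: "Im (partial a P w / P w) \<le> 0" for a
      by (rule Im_partial_quotient_nonpos[OF P w])
    have fin: "finite K" using one by (rule_tac ccontr) simp
    have "\<exists>a\<in>K. partial a P w / P w \<noteq> 0"
    proof (rule ccontr)
      assume "\<not> ?thesis"
      then have "(\<Sum>a\<in>K. partial a P w / P w) = 0" by (intro sum.neutral) auto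
      then show False using one by simp
    qed
    then obtain a where a: "a \<in> K" "partial a P w \<noteq> 0" by auto
    have "(\<Sum>a\<in>K. Im (partial a P w / P w)) = 0"
      using arg_cong[OF one, of Im] by (simp only: Im_sum one_complex.sel)
    then have "Im (partial a P w / P w) = 0"
      using sum_nonneg_eq_0_iff[OF fin, of "\<lambda>a. - Im (partial a P w / P w)"] le a
      by (simp add: sum_negf)
    moreover have "Im (partial a P w / P w) < 0"
      by (rule Im_partial_quotient_neg[OF P w a(2)])
    ultimately show False by simp
  qed
qed

text \<open>Passing to the limit from the open upper half space gives control at points with some or all
  coordinates real, which is where the barrier is used.\<close>

lemma Im_barrier_nonpos:
  assumes P: "real_multiaffine P" "uhp_stable P" and w: "\<forall>a. Im (w a) \<ge> 0" and nz: "P w \<noteq> 0"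
  shows "Im (barrier K P w) \<le> 0"
proof -
  define h where "h = (\<lambda>t. barrier K P (\<lambda>a. w a + t * 1))"
  have "continuous_on UNIV (\<lambda>t. P (\<lambda>a. w a + t * 1))"
    by (intro holomorphic_on_imp_continuous_on multiaffine_holomorphic P)
  moreover have "continuous_on UNIV (\<lambda>t. \<Sum>b\<in>K. partial b P (\<lambda>a. w a + t * 1))"
    by (intro holomorphic_on_imp_continuous_on holomorphic_on_sum multiaffine_holomorphic
        real_multiaffine_partial P)
  ultimately have "isCont (\<lambda>t. \<Sum>b\<in>K. partial b P (\<lambda>a. w a + t * 1)) 0"
      "isCont (\<lambda>t. P (\<lambda>a. w a + t * 1)) 0"
    by (auto simp: continuous_on_eq_continuous_at)
  then have "isCont h 0" unfolding h_def barrier_def using nz by (intro isCont_divide) auto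
  then have "isCont (\<lambda>\<epsilon>. h (\<i> * of_real \<epsilon>)) (0::real)"
    by (intro isCont_o2[of 0 "\<lambda>\<epsilon>::real. \<i> * of_real \<epsilon>" h]) (auto intro!: continuous_intros)
  then have "isCont (\<lambda>\<epsilon>. Im (h (\<i> * of_real \<epsilon>))) (0::real)"
    by (rule isCont_Im)
  then have lim: "((\<lambda>\<epsilon>. Im (h (\<i> * of_real \<epsilon>))) \<longlongrightarrow> Im (h 0)) (at_right 0)"
    by (simp add: isCont_def filterlim_at_split)
  have "Im (h (\<i> * of_real \<epsilon>)) \<le> 0" if "\<epsilon> > 0" for \<epsilon> :: real
  proof -
    have "Im (partial b P (\<lambda>a. w a + \<i> * of_real \<epsilon> * 1) / P (\<lambda>a. w a + \<i> * of_real \<epsilon> * 1)) \<le> 0" for b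
      by (rule Im_partial_quotient_nonpos[OF P]) (use w that in \<open>simp add: add_nonneg_pos\<close>)
    then show ?thesis unfolding h_def barrier_sum Im_sum by (intro sum_nonpos) auto
  qed
  then have "eventually (\<lambda>\<epsilon>. Im (h (\<i> * of_real \<epsilon>)) \<le> 0) (at_right 0)"
    by (intro eventually_at_right_less[THEN eventually_mono]) auto
  then have "Im (h 0) \<le> 0"
    by (rule tendsto_upperbound[OF lim]) simp
  then show ?thesis by (simp add: h_def)
qed

lemma stable_coord_nonzero:
  assumes P: "real_multiaffine P" "uhp_stable P" and w: "\<forall>a. Im (w a) \<ge> 0" and nz: "P w \<noteq> 0"
    and t: "Im t > 0"
  shows "P (w(a := w a + t)) \<noteq> 0"
proof
  assume 0: "P (w(a := w a + t)) = 0"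
  have eq: "P w + t * partial a P w = 0" using affine_step[OF P(1), of w a t] 0 by simp
  have tn: "t \<noteq> 0" using t by auto
  have "partial a P w / P w = - inverse t"
    using eq nz tn by (simp add: field_simps eq_neg_iff_add_eq_0)
  moreover have "Im (partial a P w / P w) \<le> 0"
    using Im_barrier_nonpos[OF P w nz, of "{a}"] by (simp add: barrier_def)
  moreover have "Im (- inverse t) > 0"
    using Im_inverse_neg[OF t] by simp
  ultimately show False by simp
qed

text \<open>This is a Hurwitz-type statement: stability survives specialising coordinates to real values, as
  long as the function does not vanish at the real point. Since \<open>P\<close> is affine in each coordinate, the
  coordinates of \<open>K\<close> can be moved off the real axis one at a time.\<close>

lemma stable_block_nonzero:
  assumes P: "real_multiaffine P" "uhp_stable P" and w: "\<forall>a. Im (w a) \<ge> 0" and nz: "P w \<noteq> 0"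
    and t: "Im t > 0" and "finite K"
  shows "P (\<lambda>a. w a + t * of_bool (a \<in> K)) \<noteq> 0"
  using \<open>finite K\<close>
proof (induction K)
  case empty
  then show ?case using nz by simp
next
  case (insert b K)
  define v where "v = (\<lambda>a. w a + t * of_bool (a \<in> K))"
  have "(\<lambda>a. w a + t * of_bool (a \<in> insert b K)) = v(b := v b + t)"
    using insert.hyps by (auto simp: v_def)
  moreover have "P (v(b := v b + t)) \<noteq> 0"
    by (rule stable_coord_nonzero[OF P]) (use w t insert.IH in \<open>auto simp: v_def\<close>)
  ultimately show ?case by simp
qed

text \<open>The chain rule for the diagonal direction of \<open>K\<close>, obtained by induction on \<open>K\<close> from affinity in
  each coordinate.\<close>

lemma has_derivative_block:
  assumes "finite K" "real_multiaffine P"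
  shows "((\<lambda>t. P (\<lambda>a. w a + t * of_bool (a \<in> K))) has_field_derivative
           (\<Sum>b\<in>K. partial b P (\<lambda>a. w a + t * of_bool (a \<in> K)))) (at t)"
  using assms
proof (induction K arbitrary: P)
  case empty
  then show ?case by simp
next
  case (insert b K)
  note [simp] = insert.hyps
  define v where "v = (\<lambda>t a. w a + t * of_bool (a \<in> K))"
  have v: "(\<lambda>a. w a + t * of_bool (a \<in> insert b K)) = (v t)(b := v t b + t)" for t
    by (auto simp: v_def)
  have step: "Q ((v t)(b := v t b + t)) = Q (v t) + t * partial b Q (v t)" if "real_multiaffine Q" for Q t
    by (rule affine_step[OF that])
  have "((\<lambda>t. P (v t) + t * partial b P (v t)) has_field_derivative
      (\<Sum>c\<in>K. partial c P (v t)) + (partial b P (v t) + t * (\<Sum>c\<in>K. partial c (partial b P) (v t)))) (at t)"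
    using DERIV_add[OF insert.IH[OF insert.prems]
        DERIV_mult[OF DERIV_ident insert.IH[OF real_multiaffine_partial[OF insert.prems, of b]]]]
    unfolding v_def by (simp add: algebra_simps)
  moreover have "(\<Sum>c\<in>K. partial c P (v t)) + (partial b P (v t) + t * (\<Sum>c\<in>K. partial c (partial b P) (v t)))
     = (\<Sum>c\<in>insert b K. partial c P ((v t)(b := v t b + t)))"
  proof -
    have "partial c P ((v t)(b := v t b + t)) = partial c P (v t) + t * partial c (partial b P) (v t)" for c
      using step[OF real_multiaffine_partial[OF insert.prems], of c t]
      by (simp only: partial_commute[of b c])
    then have "(\<Sum>c\<in>K. partial c P ((v t)(b := v t b + t)))
        = (\<Sum>c\<in>K. partial c P (v t)) + t * (\<Sum>c\<in>K. partial c (partial b P) (v t))"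
      by (simp only: sum.distrib sum_distrib_left)
    then show ?thesis by simp
  qed
  ultimately show ?case unfolding v by (simp only: step[OF insert.prems])
qed

section \<open>Points above the zeros\<close>

definition real_stable :: "(('a \<Rightarrow> complex) \<Rightarrow> complex) \<Rightarrow> bool" where
  "real_stable P \<longleftrightarrow> real_multiaffine P \<and> uhp_stable P"

definition cx :: "('a \<Rightarrow> real) \<Rightarrow> 'a \<Rightarrow> complex" where
  "cx x = (\<lambda>a. complex_of_real (x a))"

text \<open>In one variable this says that \<open>x\<close> exceeds the largest real root of a polynomial with positive
  leading coefficient.\<close>

definition above_zeros :: "(('a \<Rightarrow> complex) \<Rightarrow> complex) \<Rightarrow> ('a \<Rightarrow> real) \<Rightarrow> bool" where
  "above_zeros P x \<longleftrightarrow> (\<forall>y\<ge>x. Re (P (cx y)) > 0)"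

text \<open>The counterpart of a positive leading coefficient.\<close>

definition eventually_above :: "(('a \<Rightarrow> complex) \<Rightarrow> complex) \<Rightarrow> bool" where
  "eventually_above P \<longleftrightarrow> (\<forall>y. \<exists>x\<ge>y. above_zeros P x)"

lemma real_stableD:
  assumes "real_stable P"
  shows "real_multiaffine P" "uhp_stable P"
  using assms by (simp_all add: real_stable_def)

lemma real_stable_one_minus_partials:
  "real_stable P \<Longrightarrow> real_stable (one_minus_partials K P)"
  by (simp add: real_stable_def real_multiaffine_one_minus_partials stable_one_minus_partials)

lemma above_zeros_mono: "above_zeros P x \<Longrightarrow> x \<le> y \<Longrightarrow> above_zeros P y"
  unfolding above_zeros_def by (blast intro: order_trans)

lemma above_zerosD: "above_zeros P x \<Longrightarrow> x \<le> y \<Longrightarrow> Re (P (cx y)) > 0"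
  unfolding above_zeros_def by blast

lemma above_zeros_nonzero: "above_zeros P x \<Longrightarrow> x \<le> y \<Longrightarrow> P (cx y) \<noteq> 0"
  using above_zerosD[of P x y] by auto

lemma cx_real_value:
  assumes "real_multiaffine P"
  shows "P (cx x) = of_real (Re (P (cx x)))"
  using multiaffine_real[OF assms, of "cx x"] by (simp add: complex_eq_iff cx_def)

lemma barrier_cx:
  assumes "real_multiaffine P"
  shows "barrier K P (cx x) = of_real ((\<Sum>a\<in>K. Re (partial a P (cx x))) / Re (P (cx x)))"
  unfolding barrier_def
  by (subst cx_real_value[OF assms], subst cx_real_value[OF real_multiaffine_partial[OF assms]])
     (simp only: of_real_sum of_real_divide)

lemma Re_barrier_cx:
  assumes "real_multiaffine P"
  shows "Re (barrier K P (cx x)) = (\<Sum>a\<in>K. Re (partial a P (cx x))) / Re (P (cx x))"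
  by (simp add: barrier_cx[OF assms])

lemma Re_one_minus_partials_cx:
  "Re (one_minus_partials K P (cx x)) = Re (P (cx x)) - (\<Sum>a\<in>K. Re (partial a P (cx x)))"
  by (simp add: one_minus_partials_def)

lemma affine_step_cx:
  assumes "real_multiaffine P"
  shows "P (cx (x(a := x a + s))) = P (cx x) + of_real s * partial a P (cx x)"
proof -
  have "cx (x(a := x a + s)) = (cx x)(a := cx x a + of_real s)" by (auto simp: cx_def)
  then show ?thesis using affine_step[OF assms] by metis
qed

text \<open>With a negative partial derivative, the affine function of the coordinate \<open>a\<close> would reach zero
  further up.\<close>

lemma above_partial_nonneg:
  assumes P: "real_multiaffine P" and ab: "above_zeros P x"
  shows "Re (partial a P (cx x)) \<ge> 0"
proof (rule ccontr)
  define B p where "B = Re (partial a P (cx x))" and "p = Re (P (cx x))"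
  assume "\<not> ?thesis"
  then have B: "B < 0" by (simp add: B_def)
  have p: "p > 0" using above_zerosD[OF ab order_refl] by (simp add: p_def)
  define s where "s = - p / B"
  have s: "s > 0" using B p by (simp add: s_def divide_pos_neg)
  have "Re (P (cx (x(a := x a + s)))) = p + s * B"
    unfolding affine_step_cx[OF P] by (simp add: p_def B_def)
  also have "\<dots> = 0" using B by (simp add: s_def)
  finally have "Re (P (cx (x(a := x a + s)))) = 0" .
  moreover have "x \<le> x(a := x a + s)" using s by (simp add: le_fun_def)
  ultimately show False using above_zerosD[OF ab] by force
qed

lemma above_barrier_nonneg:
  assumes P: "real_multiaffine P" and ab: "above_zeros P x"
  shows "Re (barrier K P (cx x)) \<ge> 0"
  unfolding Re_barrier_cx[OF P]
  using above_partial_nonneg[OF P ab] above_zerosD[OF ab order_refl]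
  by (intro divide_nonneg_pos sum_nonneg) auto

lemma Im_barrier_nonpos_closed:
  assumes "real_stable P" "\<forall>a. Im (w a) \<ge> 0"
  shows "Im (barrier K P w) \<le> 0"
  using Im_barrier_nonpos[OF real_stableD[OF assms(1)] assms(2)]
  by (cases "P w = 0") (auto simp: barrier_def)

lemma barrier_line_differentiable:
  assumes "real_multiaffine P" "P (\<lambda>a. w a + t * v a) \<noteq> 0"
  shows "(\<lambda>t. barrier K P (\<lambda>a. w a + t * v a)) field_differentiable at t"
proof -
  have "(\<lambda>t. Q (\<lambda>a. w a + t * v a)) field_differentiable at t" if "real_multiaffine Q" for Q
    using multiaffine_holomorphic[OF that, of w v UNIV] by (simp add: holomorphic_on_def)
  then show ?thesis
    unfolding barrier_def using assms real_multiaffine_partial[OF assms(1)]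
    by (intro field_differentiable_divide field_differentiable_sum) auto
qed

text \<open>Approaching \<open>z\<close> from above along the imaginary direction turns the sign of \<open>Im h\<close> into the sign of
  the derivative.\<close>

lemma Re_deriv_nonpos:
  assumes d: "(h has_field_derivative D) (at z)" and z: "Im (h z) = 0"
    and up: "\<And>\<epsilon>. \<epsilon> > 0 \<Longrightarrow> Im (h (z + \<i> * of_real \<epsilon>)) \<le> 0"
  shows "Re D \<le> 0"
proof -
  have "((\<lambda>k. (h (z + k) - h z) / k) \<longlongrightarrow> D) (at 0)" using d by (simp add: DERIV_def)
  moreover have "filterlim (\<lambda>\<epsilon>. \<i> * complex_of_real \<epsilon>) (at 0) (at_right 0)"
  proof -
    have "((\<lambda>\<epsilon>. \<i> * complex_of_real \<epsilon>) \<longlongrightarrow> \<i> * of_real 0) (at_right 0)" by (intro tendsto_intros)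
    then show ?thesis
      unfolding filterlim_at using eventually_at_right_less[of "0::real"]
      by (auto elim!: eventually_mono)
  qed
  ultimately have "((\<lambda>\<epsilon>. (h (z + \<i> * of_real \<epsilon>) - h z) / (\<i> * of_real \<epsilon>)) \<longlongrightarrow> D) (at_right 0)"
    by (rule filterlim_compose)
  then have lim: "((\<lambda>\<epsilon>. Re ((h (z + \<i> * of_real \<epsilon>) - h z) / (\<i> * of_real \<epsilon>))) \<longlongrightarrow> Re D) (at_right 0)"
    by (rule tendsto_Re)
  have "Re ((h (z + \<i> * of_real \<epsilon>) - h z) / (\<i> * of_real \<epsilon>)) \<le> 0" if "\<epsilon> > 0" for \<epsilon> :: real
  proof -
    have "(h (z + \<i> * of_real \<epsilon>) - h z) / (\<i> * of_real \<epsilon>) = - \<i> * (h (z + \<i> * of_real \<epsilon>) - h z) / of_real \<epsilon>"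
      using that by (simp add: field_simps)
    then have "Re ((h (z + \<i> * of_real \<epsilon>) - h z) / (\<i> * of_real \<epsilon>)) = Im (h (z + \<i> * of_real \<epsilon>)) / \<epsilon>"
      using z by (simp add: Re_divide_of_real)
    then show ?thesis using up[OF that] that by (simp add: divide_nonpos_pos)
  qed
  then have "eventually (\<lambda>\<epsilon>. Re ((h (z + \<i> * of_real \<epsilon>) - h z) / (\<i> * of_real \<epsilon>)) \<le> 0) (at_right 0)"
    using eventually_at_right_less[of "0::real"] by (auto elim!: eventually_mono)
  then show ?thesis by (rule tendsto_upperbound[OF lim]) simp
qed

lemma DERIV_Re_of_real:
  assumes "(h has_field_derivative D) (at (of_real \<theta>))"
  shows "((\<lambda>s. Re (h (of_real s))) has_real_derivative Re D) (at \<theta>)"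
  using bounded_linear.has_vector_derivative[OF bounded_linear_Re
      has_vector_derivative_real_field[OF assms, of UNIV]]
  by (simp add: has_real_derivative_iff_has_vector_derivative)

lemma cx_line: "cx (\<lambda>a. x a + \<theta> * v a) = (\<lambda>a. cx x a + of_real \<theta> * cx v a)"
  by (simp add: cx_def)

lemma barrier_line_deriv_nonpos:
  fixes K :: "'a set"
  assumes P: "real_stable P" and v: "\<And>a. v a \<ge> 0"
    and nz: "P (cx (\<lambda>a. x a + \<theta> * v a)) \<noteq> 0"
  defines "h \<equiv> \<lambda>t. barrier K P (\<lambda>a. cx x a + t * cx v a)"
  shows "(h has_field_derivative deriv h (of_real \<theta>)) (at (of_real \<theta>))"
    and "Re (deriv h (of_real \<theta>)) \<le> 0"
proof -
  show d: "(h has_field_derivative deriv h (of_real \<theta>)) (at (of_real \<theta>))"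
    unfolding h_def
    by (rule field_differentiable_derivI, rule barrier_line_differentiable[OF real_stableD(1)[OF P]])
       (use nz in \<open>simp add: cx_line\<close>)
  have real: "h (of_real \<theta>) = barrier K P (cx (\<lambda>a. x a + \<theta> * v a))" by (simp add: h_def cx_line)
  show "Re (deriv h (of_real \<theta>)) \<le> 0"
  proof (rule Re_deriv_nonpos[OF d])
    show "Im (h (of_real \<theta>)) = 0" unfolding real barrier_cx[OF real_stableD(1)[OF P]] by simp
    fix \<epsilon> :: real assume "\<epsilon> > 0"
    then show "Im (h (of_real \<theta> + \<i> * of_real \<epsilon>)) \<le> 0"
      unfolding h_def by (intro Im_barrier_nonpos_closed[OF P]) (simp add: cx_def v)
  qed
qed

text \<open>On a segment in a nonnegative direction the barrier extends to a function of a complex parameter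
  that takes the upper half plane to the lower one, so its derivative at real parameters is \<open>\<le> 0\<close>.
  The hypothesis speaks of zeros on the segment alone because the segments met in
  \<open>above_zeros_of_one_minus_partials\<close> are not known to lie above the zeros.\<close>

lemma barrier_antimono_segment:
  assumes P: "real_stable P" and v: "\<And>a. v a \<ge> 0" and le: "\<alpha> \<le> \<beta>"
    and nz: "\<And>\<theta>. \<alpha> \<le> \<theta> \<Longrightarrow> \<theta> \<le> \<beta> \<Longrightarrow> P (cx (\<lambda>a. x a + \<theta> * v a)) \<noteq> 0"
  shows "Re (barrier K P (cx (\<lambda>a. x a + \<beta> * v a))) \<le> Re (barrier K P (cx (\<lambda>a. x a + \<alpha> * v a)))"
proof -
  define h where "h = (\<lambda>t. barrier K P (\<lambda>a. cx x a + t * cx v a))"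
  have "Re (h (of_real \<beta>)) \<le> Re (h (of_real \<alpha>))"
  proof (rule DERIV_nonpos_imp_nonincreasing[OF le])
    fix \<theta> assume \<theta>: "\<alpha> \<le> \<theta>" "\<theta> \<le> \<beta>"
    show "\<exists>y. ((\<lambda>s. Re (h (of_real s))) has_real_derivative y) (at \<theta>) \<and> y \<le> 0"
      using DERIV_Re_of_real barrier_line_deriv_nonpos[OF P v nz[OF \<theta>], of K]
      unfolding h_def by blast
  qed
  then show ?thesis by (simp add: h_def cx_line)
qed

lemma above_barrier_antimono:
  assumes P: "real_stable P" and ab: "above_zeros P x" and xy: "x \<le> y"
  shows "Re (barrier K P (cx y)) \<le> Re (barrier K P (cx x))"
proof -
  have "Re (barrier K P (cx (\<lambda>a. x a + 1 * (y a - x a)))) \<le> Re (barrier K P (cx (\<lambda>a. x a + 0 * (y a - x a))))"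
  proof (rule barrier_antimono_segment[OF P])
    fix \<theta> :: real assume "0 \<le> \<theta>" "\<theta> \<le> 1"
    then show "P (cx (\<lambda>a. x a + \<theta> * (y a - x a))) \<noteq> 0"
      using xy by (intro above_zeros_nonzero[OF ab]) (simp add: le_fun_def)
  qed (use xy in \<open>simp_all add: le_fun_def\<close>)
  then show ?thesis by simp
qed

lemma above_one_minus_partials:
  assumes P: "real_stable P" and ab: "above_zeros P x" and lt: "Re (barrier K P (cx x)) < 1"
  shows "above_zeros (one_minus_partials K P) x"
  unfolding above_zeros_def
proof (intro allI impI)
  fix y assume y: "x \<le> y"
  have "Re (barrier K P (cx y)) < 1" using above_barrier_antimono[OF P ab y, of K] lt by simp
  then show "Re (one_minus_partials K P (cx y)) > 0"
    using above_zerosD[OF ab y]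
    unfolding Re_one_minus_partials_cx Re_barrier_cx[OF real_stableD(1)[OF P]] by simp
qed

lemma continuous_on_cx_line:
  assumes "real_multiaffine P"
  shows "continuous_on S (\<lambda>\<theta>. Re (P (cx (\<lambda>a. x a + \<theta> * v a))))"
  unfolding cx_line
  using continuous_on_compose[of S complex_of_real "\<lambda>t. P (\<lambda>a. cx x a + t * cx v a)"]
    holomorphic_on_imp_continuous_on[OF multiaffine_holomorphic[OF assms, of "cx x" "cx v"]]
  by (intro continuous_on_Re) (auto simp: o_def)

text \<open>In terms of largest roots: averaging over a block does not decrease the largest root. If \<open>P\<close> were not
  positive at some \<open>y \<ge> x\<close>, follow the segment from a point above the zeros of \<open>P\<close> back to \<open>y\<close> until
  \<open>P\<close> stops being positive, at parameter \<open>\<sigma>\<close>. On the way the barrier only grows, so that the sum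
  of the partial derivatives stays nonnegative, up to \<open>\<sigma>\<close> by continuity. But there \<open>P \<le> 0\<close> and
  \<open>P - \<Sum> \<partial>\<^sub>a P > 0\<close>.\<close>

lemma above_zeros_of_one_minus_partials:
  assumes P: "real_stable P" "eventually_above P" and ab: "above_zeros (one_minus_partials K P) x"
  shows "above_zeros P x"
proof (rule ccontr)
  assume "\<not> ?thesis"
  then obtain y where y: "x \<le> y" "Re (P (cx y)) \<le> 0" unfolding above_zeros_def by force
  obtain z where z: "y \<le> z" "above_zeros P z" using P(2) unfolding eventually_above_def by blast
  note ma = real_stableD(1)[OF P(1)]
  define l where "l = (\<lambda>\<theta> a. y a + \<theta> * (z a - y a))"
  define q where "q = (\<lambda>\<theta>. Re (P (cx (l \<theta>))))"
  define n where "n = (\<lambda>\<theta>. \<Sum>a\<in>K. Re (partial a P (cx (l \<theta>))))"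
  have l01: "l 0 = y" "l 1 = z" by (auto simp: l_def)
  have ly: "x \<le> l \<theta>" if "\<theta> \<ge> 0" for \<theta>
    using that z(1) y(1) by (simp add: l_def le_fun_def add_increasing2)
  have cont: "continuous_on UNIV q" "continuous_on UNIV n"
    unfolding q_def n_def l_def
    by (intro continuous_on_sum continuous_on_cx_line real_multiaffine_partial ma)+
  define T where "T = {0..1} \<inter> q -` {..0}"
  have "closed (q -` {..0})"
    using cont(1) by (intro closed_vimage) auto
  then have "compact T" unfolding T_def by (intro compact_Int_closed) auto
  moreover have "0 \<in> T" using y by (simp add: T_def q_def l01)
  ultimately obtain \<sigma> where \<sigma>: "\<sigma> \<in> T" "\<And>t. t \<in> T \<Longrightarrow> t \<le> \<sigma>"
    using compact_attains_sup[of T] by blast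
  have q1: "q 1 > 0" using above_zerosD[OF z(2) order_refl] by (simp add: q_def l01)
  have s01: "0 \<le> \<sigma>" "\<sigma> < 1" "q \<sigma> \<le> 0" using \<sigma>(1) q1 by (auto simp: T_def less_le)
  have qpos: "q \<theta> > 0" if "\<sigma> < \<theta>" "\<theta> \<le> 1" for \<theta>
    using \<sigma>(2)[of \<theta>] that s01 by (force simp: T_def)
  have npos: "n \<theta> \<ge> 0" if \<theta>: "\<sigma> < \<theta>" "\<theta> \<le> 1" for \<theta>
  proof -
    have "0 \<le> Re (barrier K P (cx (l 1)))"
      unfolding l01 by (rule above_barrier_nonneg[OF ma z(2)])
    also have "\<dots> \<le> Re (barrier K P (cx (l \<theta>)))"
      unfolding l_def
    proof (rule barrier_antimono_segment[OF P(1) _ \<theta>(2)])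
      fix \<eta> assume "\<theta> \<le> \<eta>" "\<eta> \<le> 1"
      then have "q \<eta> > 0" using \<theta> by (intro qpos) auto
      then show "P (cx (\<lambda>a. y a + \<eta> * (z a - y a))) \<noteq> 0" by (auto simp: q_def l_def)
    qed (use z(1) in \<open>simp add: le_fun_def\<close>)
    also have "\<dots> = n \<theta> / q \<theta>" unfolding Re_barrier_cx[OF ma] n_def q_def ..
    finally show ?thesis using qpos[OF \<theta>] by (simp add: zero_le_divide_iff)
  qed
  have "(n \<longlongrightarrow> n \<sigma>) (at_right \<sigma>)"
    using cont(2) by (simp add: continuous_on_eq_continuous_at isCont_def filterlim_at_split)
  moreover have "eventually (\<lambda>\<theta>. n \<theta> \<ge> 0) (at_right \<sigma>)"
    using eventually_at_right_real[OF s01(2)] by (rule eventually_mono) (use npos in auto)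
  ultimately have "n \<sigma> \<ge> 0" by (rule tendsto_lowerbound) simp
  moreover have "q \<sigma> - n \<sigma> > 0"
    using above_zerosD[OF ab ly[OF s01(1)]] unfolding Re_one_minus_partials_cx q_def n_def .
  ultimately show False using s01(3) by linarith
qed

text \<open>Moving the coordinate \<open>a\<close> up by \<open>s\<close> brings \<open>\<partial>\<^sub>a P / P\<close> below \<open>1 / s\<close>, so moving the whole block by
  more than its cardinality brings the barrier below 1.\<close>

lemma eventually_above_one_minus_partials:
  assumes P: "real_stable P" "eventually_above P" and fin: "finite K"
  shows "eventually_above (one_minus_partials K P)"
  unfolding eventually_above_def
proof
  fix y :: "'a \<Rightarrow> real"
  obtain z where z: "y \<le> z" "above_zeros P z" using P(2) unfolding eventually_above_def by blast
  note ma = real_stableD(1)[OF P(1)]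
  define s where "s = real (card K) + 1"
  define x where "x = (\<lambda>a. z a + s * of_bool (a \<in> K))"
  have s: "s > 0" by (simp add: s_def)
  have zx: "z \<le> x" using s by (simp add: x_def le_fun_def)
  have single: "Re (barrier {a} P (cx x)) \<le> 1 / s" if "a \<in> K" for a
  proof -
    define p B where "p = Re (P (cx z))" and "B = Re (partial a P (cx z))"
    have p: "p > 0" "B \<ge> 0"
      unfolding p_def B_def using above_zerosD[OF z(2) order_refl] above_partial_nonneg[OF ma z(2)] by auto
    define z' where "z' = z(a := z a + s)"
    have zz': "z \<le> z'" using s by (simp add: z'_def le_fun_def)
    have z'x: "z' \<le> x" using that s by (simp add: z'_def x_def le_fun_def)
    have "partial a P (cx z') = partial a P (cx z)"
      using partial_upd_same[of a P "cx z" "of_real (z a + s)"]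
      by (simp add: z'_def cx_def fun_upd_def if_distrib cong: if_cong)
    then have "Re (barrier {a} P (cx z')) = B / (p + s * B)"
      unfolding Re_barrier_cx[OF ma] by (simp add: z'_def affine_step_cx[OF ma] p_def B_def)
    also have "\<dots> \<le> 1 / s" using p s by (simp add: frac_le_eq field_simps add_pos_nonneg)
    finally show ?thesis
      using above_barrier_antimono[OF P(1) above_zeros_mono[OF z(2) zz'] z'x, of "{a}"] by simp
  qed
  have "Re (barrier K P (cx x)) = (\<Sum>a\<in>K. Re (barrier {a} P (cx x)))"
    unfolding Re_barrier_cx[OF ma] by (simp add: sum_divide_distrib)
  also have "\<dots> \<le> (\<Sum>a\<in>K. 1 / s)" by (intro sum_mono single)
  also have "\<dots> < 1" using s by (simp add: s_def)
  finally have "above_zeros (one_minus_partials K P) x"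
    by (rule above_one_minus_partials[OF P(1) above_zeros_mono[OF z(2) zx]])
  then show "\<exists>x\<ge>y. above_zeros (one_minus_partials K P) x" using order_trans[OF z(1) zx] by blast
qed

section \<open>Choosing one shift in each block\<close>

definition shift_coord :: "'a \<Rightarrow> real \<Rightarrow> (('a \<Rightarrow> complex) \<Rightarrow> complex) \<Rightarrow> ('a \<Rightarrow> complex) \<Rightarrow> complex" where
  "shift_coord a s P w = P (w(a := w a + of_real s))"

lemma partial_shift_coord:
  "a \<noteq> b \<Longrightarrow> partial b (shift_coord a s P) = shift_coord a s (partial b P)"
  by (auto simp: partial_def shift_coord_def fun_upd_twist fun_eq_iff)

lemma one_minus_partials_shift_coord:
  "a \<notin> K \<Longrightarrow> one_minus_partials K (shift_coord a s P) = shift_coord a s (one_minus_partials K P)"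
proof
  fix w assume "a \<notin> K"
  then have "(\<Sum>b\<in>K. partial b (shift_coord a s P) w) = (\<Sum>b\<in>K. partial b P (w(a := w a + of_real s)))"
    by (intro sum.cong refl, subst partial_shift_coord) (auto simp: shift_coord_def)
  then show "one_minus_partials K (shift_coord a s P) w = shift_coord a s (one_minus_partials K P) w"
    by (simp add: one_minus_partials_def shift_coord_def)
qed

lemma shift_coord_affine:
  assumes "real_multiaffine P"
  shows "shift_coord a s P w = P w + of_real s * partial a P w"
  unfolding shift_coord_def by (rule affine_step[OF assms])

lemma real_stable_shift_coord:
  assumes "real_stable P"
  shows "real_stable (shift_coord a s P)"
proof -
  note P = real_stableD[OF assms]
  have "real_multiaffine (shift_coord a s P)"
    unfolding real_multiaffine_def
  proof (intro conjI allI)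
    fix w b x
    show "shift_coord a s P (w(b := x)) = shift_coord a s P (w(b := 0)) + x * partial b (shift_coord a s P) w"
    proof (cases "b = a")
      case True
      show ?thesis
        unfolding True shift_coord_affine[OF P(1)] partial_def[of a "shift_coord a s P"]
        using affine_coord[OF P(1), of w a x]
        by (simp add: partial_def[of a P] algebra_simps)
    next
      case False
      then show ?thesis
        unfolding partial_shift_coord[OF False[symmetric]]
        using affine_coord[OF P(1), of "w(a := w a + of_real s)" b x]
        by (simp add: shift_coord_def fun_upd_twist)
    qed
  next
    fix w :: "'a \<Rightarrow> complex"
    show "shift_coord a s P (\<lambda>b. cnj (w b)) = cnj (shift_coord a s P w)"
      unfolding shift_coord_affine[OF P(1)]
      by (simp add: multiaffine_cnj[OF P(1)] multiaffine_cnj[OF real_multiaffine_partial[OF P(1)]])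
  next
    fix w v :: "'a \<Rightarrow> complex"
    show "(\<lambda>t. shift_coord a s P (\<lambda>b. w b + t * v b)) holomorphic_on UNIV"
      unfolding shift_coord_affine[OF P(1)]
      by (intro holomorphic_intros multiaffine_holomorphic real_multiaffine_partial P)
  qed
  moreover have "uhp_stable (shift_coord a s P)"
    using P(2) by (auto simp: uhp_stable_def shift_coord_def)
  ultimately show ?thesis by (simp add: real_stable_def)
qed

lemma shift_coord_cx: "shift_coord a s P (cx x) = P (cx (x(a := x a + s)))"
proof -
  have "(cx x)(a := cx x a + of_real s) = cx (x(a := x a + s))" by (auto simp: cx_def)
  then show ?thesis by (simp add: shift_coord_def)
qed

lemma eventually_above_shift_coord:
  assumes "eventually_above P"
  shows "eventually_above (shift_coord a s P)"
  unfolding eventually_above_def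
proof
  fix y :: "'a \<Rightarrow> real"
  obtain x where x: "y(a := y a + s) \<le> x" "above_zeros P x" using assms unfolding eventually_above_def by blast
  have "above_zeros (shift_coord a s P) (x(a := x a - s))"
    unfolding above_zeros_def
  proof (intro allI impI)
    fix z assume "x(a := x a - s) \<le> z"
    then have "x \<le> z(a := z a + s)" by (auto simp: le_fun_def dest: spec[of _ a] split: if_splits)
    then show "Re (shift_coord a s P (cx z)) > 0" unfolding shift_coord_cx by (rule above_zerosD[OF x(2)])
  qed
  moreover have "y \<le> x(a := x a - s)" using x(1) by (auto simp: le_fun_def dest: spec[of _ a] split: if_splits)
  ultimately show "\<exists>x\<ge>y. above_zeros (shift_coord a s P) x" by blast
qed

text \<open>The condition \<open>\<Sum> \<partial>\<^sub>a P / P < 1\<close> at \<open>x\<close> forces \<open>\<partial>\<^sub>a P / P < 1 / card K\<close> at \<open>x\<close> for some \<open>a\<close>, and by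
  monotonicity the same \<open>a\<close> serves at all points above \<open>x\<close>.\<close>

lemma select_shift:
  assumes P: "real_stable P" "eventually_above P" and fin: "finite K" "K \<noteq> {}"
    and ab: "above_zeros (one_minus_partials K P) x"
  shows "\<exists>a\<in>K. above_zeros (shift_coord a (- real (card K)) P) x"
proof -
  note ma = real_stableD(1)[OF P(1)]
  have abP: "above_zeros P x" by (rule above_zeros_of_one_minus_partials[OF P ab])
  define c where "c = real (card K)"
  have c: "c > 0" using fin by (simp add: c_def card_gt_0_iff)
  have "(\<Sum>a\<in>K. Re (barrier {a} P (cx x))) < 1"
    using above_zerosD[OF ab order_refl] above_zerosD[OF abP order_refl]
    unfolding Re_barrier_cx[OF ma] Re_one_minus_partials_cx by (simp add: sum_divide_distrib[symmetric])
  moreover have "1 = (\<Sum>a\<in>K. 1 / c)" using c by (simp add: c_def)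
  ultimately obtain a where a: "a \<in> K" "Re (barrier {a} P (cx x)) < 1 / c"
    using sum_mono[of K "\<lambda>_. 1 / c" "\<lambda>a. Re (barrier {a} P (cx x))"] by force
  have "above_zeros (shift_coord a (- c) P) x"
    unfolding above_zeros_def
  proof (intro allI impI)
    fix y assume y: "x \<le> y"
    have "Re (barrier {a} P (cx y)) < 1 / c"
      using above_barrier_antimono[OF P(1) abP y, of "{a}"] a(2) by simp
    then show "Re (shift_coord a (- c) P (cx y)) > 0"
      using above_zerosD[OF abP y] c
      unfolding Re_barrier_cx[OF ma] shift_coord_affine[OF ma] by (simp add: field_simps)
  qed
  then show ?thesis using a(1) c_def by blast
qed

primrec iterated_minus_partials :: "(nat \<Rightarrow> 'a set) \<Rightarrow> nat \<Rightarrow> (('a \<Rightarrow> complex) \<Rightarrow> complex) \<Rightarrow> ('a \<Rightarrow> complex) \<Rightarrow> complex" where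
  "iterated_minus_partials K 0 P = P"
| "iterated_minus_partials K (Suc n) P = one_minus_partials (K n) (iterated_minus_partials K n P)"

lemma real_stable_iterated:
  "real_stable P \<Longrightarrow> real_stable (iterated_minus_partials K n P)"
  by (induction n) (auto intro: real_stable_one_minus_partials)

lemma eventually_above_iterated:
  assumes "real_stable P" "eventually_above P" "\<And>i. finite (K i)"
  shows "eventually_above (iterated_minus_partials K n P)"
  by (induction n) (auto intro: assms eventually_above_one_minus_partials real_stable_iterated)

lemma iterated_shift_coord:
  "(\<And>i. i < n \<Longrightarrow> a \<notin> K i) \<Longrightarrow>
    iterated_minus_partials K n (shift_coord a s P) = shift_coord a s (iterated_minus_partials K n P)"
  by (induction n) (auto simp: one_minus_partials_shift_coord)

text \<open>The outermost average is resolved first. The shift chosen for it commutes with the averages over the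
  other blocks, so it can be moved inside, next to \<open>P\<close>, and the induction continues with the shifted
  function.\<close>

lemma select_shifts:
  assumes "real_stable P" "eventually_above P"
    and K: "\<And>i. finite (K i)" "\<And>i. card (K i) = r" "r > 0" "\<And>i j. i \<noteq> j \<Longrightarrow> K i \<inter> K j = {}"
    and "above_zeros (iterated_minus_partials K n P) x"
  shows "\<exists>\<kappa>. (\<forall>i<n. \<kappa> i \<in> K i) \<and>
    (\<forall>y\<ge>x. Re (P (cx (\<lambda>a. y a - real r * of_bool (a \<in> \<kappa> ` {..<n})))) > 0)"
  using assms(1,2,7)
proof (induction n arbitrary: P)
  case 0
  then show ?case by (auto simp: above_zeros_def)
next
  case (Suc n)
  have "K n \<noteq> {}" using K(2,3) by (metis card.empty less_numeral_extra(3))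
  then obtain a where a: "a \<in> K n"
    and ab: "above_zeros (shift_coord a (- real r) (iterated_minus_partials K n P)) x"
    using select_shift[OF real_stable_iterated[OF Suc.prems(1)]
        eventually_above_iterated[OF Suc.prems(1,2) K(1)] K(1), of n] Suc.prems(3) K(2)
    by force
  have an: "a \<notin> K i" if "i < n" for i using a K(4)[of i n] that by auto
  have "above_zeros (iterated_minus_partials K n (shift_coord a (- real r) P)) x"
    using ab an by (simp add: iterated_shift_coord)
  from Suc.IH[OF real_stable_shift_coord[OF Suc.prems(1)] eventually_above_shift_coord[OF Suc.prems(2)] this]
  obtain \<kappa> where \<kappa>: "\<forall>i<n. \<kappa> i \<in> K i"
    and pos: "\<And>y. x \<le> y \<Longrightarrow>
      Re (shift_coord a (- real r) P (cx (\<lambda>b. y b - real r * of_bool (b \<in> \<kappa> ` {..<n})))) > 0"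
    by blast
  define \<kappa>' where "\<kappa>' = \<kappa>(n := a)"
  have im: "\<kappa>' ` {..<Suc n} = insert a (\<kappa> ` {..<n})"
    by (auto simp: \<kappa>'_def lessThan_Suc image_iff)
  have anew: "a \<notin> \<kappa> ` {..<n}" using \<kappa> an by auto
  have "(\<lambda>b. y b - real r * of_bool (b \<in> \<kappa> ` {..<n}))(a := y a - real r * of_bool (a \<in> \<kappa> ` {..<n}) + - real r)
      = (\<lambda>b. y b - real r * of_bool (b \<in> \<kappa>' ` {..<Suc n}))" for y
    using anew unfolding im by (auto simp: fun_eq_iff)
  then have "\<forall>y\<ge>x. Re (P (cx (\<lambda>b. y b - real r * of_bool (b \<in> \<kappa>' ` {..<Suc n})))) > 0"
    using pos unfolding shift_coord_cx by metis
  moreover have "\<forall>i<Suc n. \<kappa>' i \<in> K i" using \<kappa> a by (auto simp: \<kappa>'_def less_Suc_eq)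
  ultimately show ?case by blast
qed

section \<open>Convexity of Nevanlinna functions on a slit plane\<close>

lemma circle_kernel:
  fixes r w :: complex assumes "w \<noteq> 0" "r \<noteq> 0"
  shows "(2 * (r / w\<^sup>2 - 1 / r) - (r\<^sup>2 / w ^ 3 - w / r\<^sup>2)) * w
     = 2 * (r / w - w / r) - ((r / w)\<^sup>2 - (w / r)\<^sup>2)"
proof -
  have "r / w\<^sup>2 * w = r / w" "1 / r * w = w / r" "r\<^sup>2 / w ^ 3 * w = (r / w)\<^sup>2" "w / r\<^sup>2 * w = (w / r)\<^sup>2"
    using assms by (simp_all add: power2_eq_square power3_eq_cube)
  then show ?thesis unfolding left_diff_distrib mult.assoc by simp
qed

text \<open>If \<open>- H\<close> is typically real with coefficients \<open>a\<^sub>n\<close>, then \<open>a\<^sub>2 \<le> 2 a\<^sub>1\<close>: on a circle of radius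
  \<open>\<rho>\<close>, the Cauchy integrals for \<open>2 \<rho> H\<^sub>1 - \<rho>\<^sup>2 H\<^sub>2\<close>, where \<open>H\<^sub>n\<close> is the coefficient of \<open>w\<^sup>n\<close> in \<open>H\<close>,
  combined with the vanishing integrals of \<open>H\<close> and \<open>w H\<close>, have as the real part of their integrand
  a positive multiple of \<open>Im H sin \<theta> (1 - cos \<theta>)\<close>, which is pointwise \<open>\<le> 0\<close>.\<close>

lemma typically_real_coeffs:
  assumes hol: "H holomorphic_on ball 0 1"
    and sgn: "\<And>w. w \<in> ball 0 1 \<Longrightarrow> Im (H w) * Im w \<le> 0"
  shows "2 * Re (deriv H 0) - Re (deriv (deriv H) 0) / 2 \<le> 0"
proof -
  define D1 D2 where "D1 = deriv H 0" and "D2 = deriv (deriv H) 0"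
  have ineq: "2 * Re D1 - \<rho> * (Re D2 / 2) \<le> 0" if \<rho>: "0 < \<rho>" "\<rho> < 1" for \<rho> :: real
  proof -
    let ?g = "circlepath 0 \<rho>"
    define k where "k = (\<lambda>w :: complex. 2 * (\<rho> / w\<^sup>2 - 1 / \<rho>) - (\<rho>\<^sup>2 / w ^ 3 - w / \<rho>\<^sup>2))"
    define X where "X = 2 * \<rho> * D1 - \<rho>\<^sup>2 * (D2 / 2)"
    have sub: "cball 0 \<rho> \<subseteq> (ball 0 1 :: complex set)" using \<rho> by auto
    have cont: "continuous_on (cball 0 \<rho>) H" and hol': "H holomorphic_on ball 0 \<rho>"
      using hol sub by (auto intro: holomorphic_on_imp_continuous_on holomorphic_on_subset
          continuous_on_subset simp: subset_iff)
    have c: "((\<lambda>u. H u / (u - 0) ^ Suc n) has_contour_integral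
        (2 * pi * \<i> / fact n) * (deriv ^^ n) H 0) ?g" for n
      by (rule Cauchy_has_contour_integral_higher_derivative_circlepath[OF cont hol']) (use \<rho> in simp)
    have c1: "((\<lambda>u. H u / u\<^sup>2) has_contour_integral 2 * pi * \<i> * D1) ?g"
      using c[of 1] by (simp add: D1_def power2_eq_square)
    have c2: "((\<lambda>u. H u / u ^ 3) has_contour_integral 2 * pi * \<i> * (D2 / 2)) ?g"
      using c[of "Suc (Suc 0)"] by (simp add: D2_def power3_eq_cube mult.assoc)
    have g: "path_image ?g \<subseteq> ball 0 1" using \<rho> by auto
    have c3: "(H has_contour_integral 0) ?g"
      by (rule Cauchy_theorem_convex_simple[OF hol convex_ball _ g]) auto
    have c4: "((\<lambda>u. u * H u) has_contour_integral 0) ?g"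
      by (rule Cauchy_theorem_convex_simple[OF _ convex_ball _ g]) (auto intro!: holomorphic_intros hol)
    have "((\<lambda>u. 2 * \<rho> * (H u / u\<^sup>2) - 2 / \<rho> * H u - (\<rho>\<^sup>2 * (H u / u ^ 3) - 1 / \<rho>\<^sup>2 * (u * H u)))
        has_contour_integral
          2 * \<rho> * (2 * pi * \<i> * D1) - complex_of_real (2 / \<rho>) * 0
            - (\<rho>\<^sup>2 * (2 * pi * \<i> * (D2 / 2)) - complex_of_real (1 / \<rho>\<^sup>2) * 0)) ?g"
      by (intro has_contour_integral_diff has_contour_integral_lmul c1 c2 c3 c4)
    then have "((\<lambda>u. H u * k u) has_contour_integral 2 * pi * \<i> * X) ?g"
      by (simp add: k_def X_def algebra_simps)
    then have "((\<lambda>t. H (?g t) * k (?g t) * vector_derivative ?g (at t within {0..1}))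
        has_integral 2 * pi * \<i> * X) {0..1}"
      by (simp add: has_contour_integral_def)
    from has_integral_linear[OF this bounded_linear_Im]
    have int: "((\<lambda>t. Im (H (?g t) * k (?g t) * vector_derivative ?g (at t within {0..1})))
        has_integral 2 * pi * Re X) {0..1}"
      by (simp add: o_def)
    have "Im (H (?g t) * k (?g t) * vector_derivative ?g (at t within {0..1})) \<le> 0"
      if t: "t \<in> {0..1}" for t
    proof -
      define e where "e = exp (of_real (2 * pi * t) * \<i>)"
      have e: "cmod e = 1" unfolding e_def by (metis norm_exp_i_times mult.commute)
      then have e0: "e \<noteq> 0" by auto
      have ee: "1 / e = cnj e" using complex_div_cnj[of 1 e] e by simp
      have w: "?g t = \<rho> * e" by (simp add: circlepath_def part_circlepath_def linepath_def e_def algebra_simps)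
      have v: "vector_derivative ?g (at t within {0..1}) = 2 * pi * \<i> * (\<rho> * e)"
        using vector_derivative_circlepath01[of t 0 \<rho>] t by (simp add: e_def mult_ac)
      have "k (\<rho> * e) * (\<rho> * e) = 2 * (\<rho> / (\<rho> * e) - (\<rho> * e) / \<rho>)
          - ((\<rho> / (\<rho> * e))\<^sup>2 - ((\<rho> * e) / \<rho>)\<^sup>2)"
        unfolding k_def of_real_power of_real_divide of_real_1 by (rule circle_kernel) (use \<rho> e0 in simp_all)
      moreover have "complex_of_real \<rho> / (\<rho> * e) = 1 / e" "(\<rho> * e) / \<rho> = e"
        using \<rho> by simp_all
      ultimately have "k (\<rho> * e) * (\<rho> * e) = 2 * (1 / e - e) - ((1 / e)\<^sup>2 - e\<^sup>2)"
        by (simp only:)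
      also have "\<dots> = -4 * \<i> * of_real (Im e * (1 - Re e))"
        unfolding ee by (simp add: complex_eq_iff power2_eq_square algebra_simps)
      finally have k: "k (\<rho> * e) * (\<rho> * e) = -4 * \<i> * of_real (Im e * (1 - Re e))" .
      have "H (\<rho> * e) * k (\<rho> * e) * (2 * pi * \<i> * (\<rho> * e))
          = 2 * pi * \<i> * H (\<rho> * e) * (k (\<rho> * e) * (\<rho> * e))" by (simp add: mult_ac)
      also have "\<dots> = of_real (8 * pi * (Im e * (1 - Re e))) * H (\<rho> * e)"
        unfolding k by (simp add: complex_eq_iff algebra_simps)
      finally have eq: "H (\<rho> * e) * k (\<rho> * e) * (2 * pi * \<i> * (\<rho> * e))
          = of_real (8 * pi * (Im e * (1 - Re e))) * H (\<rho> * e)" .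
      have "Im (H (\<rho> * e) * k (\<rho> * e) * (2 * pi * \<i> * (\<rho> * e)))
          = 8 * pi / \<rho> * (1 - Re e) * (Im (H (\<rho> * e)) * Im (\<rho> * e))"
        unfolding eq using \<rho> by simp
      also have "\<dots> \<le> 0"
      proof (rule mult_nonneg_nonpos)
        show "0 \<le> 8 * pi / \<rho> * (1 - Re e)"
          using \<rho> complex_Re_le_cmod[of e] e by simp
        show "Im (H (\<rho> * e)) * Im (\<rho> * e) \<le> 0"
          by (rule sgn) (use \<rho> e in \<open>simp add: norm_mult\<close>)
      qed
      finally show ?thesis unfolding w v .
    qed
    then have "2 * pi * Re X \<le> 0"
      by (intro has_integral_le[OF int has_integral_0]) auto
    then have "Re X \<le> 0" using pi_gt_zero by (simp add: mult_le_0_iff not_le)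
    moreover have "Re X = \<rho> * (2 * Re D1 - \<rho> * (Re D2 / 2))"
      by (simp add: X_def algebra_simps power2_eq_square)
    ultimately show ?thesis using \<rho> by (simp add: mult_le_0_iff)
  qed
  have "((\<lambda>\<rho>. 2 * Re D1 - \<rho> * (Re D2 / 2)) \<longlongrightarrow> 2 * Re D1 - 1 * (Re D2 / 2)) (at_left 1)"
    by (intro tendsto_intros)
  moreover have "eventually (\<lambda>\<rho>. 2 * Re D1 - \<rho> * (Re D2 / 2) \<le> 0) (at_left (1::real))"
    using eventually_at_left_real[of 0 1] by (rule eventually_mono) (use ineq in auto)
  ultimately have "2 * Re D1 - 1 * (Re D2 / 2) \<le> 0"
    by (rule tendsto_upperbound) simp
  then show ?thesis by (simp add: D1_def D2_def)
qed

text \<open>Such an \<open>h\<close> is a nonnegative combination of \<open>1 / (t + s)\<close>, \<open>s \<ge> c\<close>, up to limits and a constant, so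
  it is convex to the right of \<open>- c\<close>. To avoid the integral representation, pull \<open>h\<close> back to the unit
  disc by the Koebe function \<open>K\<close>, which maps the disc onto the plane slit along the half line from
  \<open>- c\<close> to \<open>- \<infinity>\<close> and respects the half planes. As \<open>K w = 4 c (w + 2 w\<^sup>2 + \<dots>)\<close>, the first derivative of \<open>h\<close>
  cancels in the coefficient inequality and exactly the sign of \<open>h''\<close> remains.\<close>

lemma second_deriv_nonneg_slit:
  fixes c :: real
  defines "U \<equiv> {t :: complex. Im t \<noteq> 0 \<or> Re t > - c}"
  assumes c: "c > 0" and hol: "h holomorphic_on U"
    and neg: "\<And>t. Im t > 0 \<Longrightarrow> Im (h t) \<le> 0"
    and sym: "\<And>t. t \<in> U \<Longrightarrow> h (cnj t) = cnj (h t)"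
  shows "Re (deriv (deriv h) 0) \<ge> 0"
proof -
  define K K' where "K = (\<lambda>w :: complex. 4 * c * w / (1 - w)\<^sup>2)"
    and "K' = (\<lambda>w :: complex. 4 * c * (1 + w) / (1 - w) ^ 3)"
  have "U = {t. Im t > 0} \<union> {t. Im t < 0} \<union> {t. Re t > - c}" by (auto simp: U_def)
  moreover have "open \<dots>"
    by (intro open_Un open_halfspace_Im_gt open_halfspace_Im_lt open_halfspace_Re_gt)
  ultimately have opU: "open U" by simp
  have ne: "1 - w \<noteq> 0" if "w \<in> ball 0 1" for w :: complex using that by auto
  have dK: "(K has_field_derivative K' w) (at w)" if "w \<in> ball 0 1" for w
  proof -
    define d where "d = 1 - w"
    have d: "w = 1 - d" "d \<noteq> 0" using ne[OF that] by (simp_all add: d_def)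
    have "(K has_field_derivative
        (4 * c * (1 - w)\<^sup>2 - 4 * c * w * (2 * (1 - w) * (- 1))) / ((1 - w)\<^sup>2 * (1 - w)\<^sup>2)) (at w)"
      unfolding K_def using ne[OF that] by (auto intro!: derivative_eq_intros)
    moreover have "(4 * c * (1 - w)\<^sup>2 - 4 * c * w * (2 * (1 - w) * (- 1))) / ((1 - w)\<^sup>2 * (1 - w)\<^sup>2) = K' w"
      unfolding K'_def d(1) using d(2) by (simp add: field_simps power2_eq_square power3_eq_cube)
    ultimately show ?thesis by simp
  qed
  have dK': "(K' has_field_derivative 16 * c) (at 0)"
    unfolding K'_def by (auto intro!: derivative_eq_intros)
  have ImK: "Im (K w) = 4 * c * (Im w * (1 - (cmod w)\<^sup>2)) / (cmod (1 - w)) ^ 4" if "w \<in> ball 0 1" for w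
  proof -
    have "K w = 4 * c * (w * cnj ((1 - w)\<^sup>2)) / ((cmod (1 - w)) ^ 4)"
      unfolding K_def using ne[OF that]
      by (simp add: complex_div_cnj[of _ "(1 - w)\<^sup>2"] norm_power power_mult[symmetric])
    also have "Im \<dots> = 4 * c * Im (w * cnj ((1 - w)\<^sup>2)) / (cmod (1 - w)) ^ 4"
      by (simp add: Im_divide_of_real[symmetric] del: of_real_power)
    also have "Im (w * cnj ((1 - w)\<^sup>2)) = Im w * (1 - (cmod w)\<^sup>2)"
      unfolding cmod_power2 by (simp add: power2_eq_square algebra_simps)
    finally show ?thesis .
  qed
  have pos: "4 * c * (1 - (cmod w)\<^sup>2) / (cmod (1 - w)) ^ 4 > 0" if "w \<in> ball 0 1" for w
    using that c ne[OF that] by (simp add: abs_square_less_1 power2_eq_square[symmetric])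
  have KU: "K w \<in> U" if w: "w \<in> ball 0 1" for w
  proof (cases "Im w = 0")
    case False
    then have "Im (K w) \<noteq> 0" using ImK[OF w] pos[OF w] by auto
    then show ?thesis by (simp add: U_def)
  next
    case True
    define x where "x = Re w"
    have wx: "w = of_real x" using True by (simp add: x_def complex_eq_iff)
    then have x: "\<bar>x\<bar> < 1" using w by simp
    have "K w = of_real (4 * c * x / (1 - x)\<^sup>2)" by (simp add: K_def wx)
    moreover have "4 * c * x / (1 - x)\<^sup>2 + c = c * (1 + x)\<^sup>2 / (1 - x)\<^sup>2"
    proof -
      have "4 * c * x + c * (1 - x)\<^sup>2 = c * (1 + x)\<^sup>2"
        by (simp add: power2_eq_square algebra_simps)
      moreover have "(1 - x)\<^sup>2 \<noteq> 0" using x by auto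
      ultimately show ?thesis
        by (metis add_divide_distrib nonzero_mult_div_cancel_right)
    qed
    moreover have "c * (1 + x)\<^sup>2 / (1 - x)\<^sup>2 > 0" using x c by auto
    ultimately show ?thesis by (simp add: U_def)
  qed
  define H where "H = (\<lambda>w. h (K w))"
  have dH: "(H has_field_derivative deriv h (K w) * K' w) (at w)" if "w \<in> ball 0 1" for w
    unfolding H_def
    by (rule DERIV_chain2[OF _ dK[OF that]])
       (rule holomorphic_derivI[OF hol opU KU[OF that]])
  have "H holomorphic_on ball 0 1"
    using dH unfolding holomorphic_on_open[OF open_ball] by blast
  moreover have "Im (H w) * Im w \<le> 0" if w: "w \<in> ball 0 1" for w
  proof (cases "Im w" "0 :: real" rule: linorder_cases)
    case greater
    then have "Im (K w) > 0" using mult_pos_pos[OF _ pos[OF w], of "Im w"] ImK[OF w] by (simp add: mult_ac)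
    then show ?thesis using neg greater by (simp add: H_def mult_le_0_iff)
  next
    case less
    then have "Im (K w) < 0" using mult_neg_pos[OF _ pos[OF w], of "Im w"] ImK[OF w] by (simp add: mult_ac)
    then have "Im (h (cnj (K w))) \<le> 0" by (intro neg) simp
    then show ?thesis using less sym[OF KU[OF w]] by (simp add: H_def mult_le_0_iff)
  qed simp
  ultimately have main: "2 * Re (deriv H 0) - Re (deriv (deriv H) 0) / 2 \<le> 0"
    by (rule typically_real_coeffs)
  have K0: "K 0 = 0" "K' 0 = 4 * c" by (simp_all add: K_def K'_def)
  have zero: "0 \<in> ball (0 :: complex) 1" "0 \<in> U" using c by (simp_all add: U_def)
  have d1: "deriv H 0 = 4 * c * deriv h 0"
    using DERIV_imp_deriv[OF dH[OF zero(1)]] K0 by simp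
  have "((\<lambda>w. deriv h (K w) * K' w) has_field_derivative
      deriv (deriv h) (K 0) * K' 0 * K' 0 + 16 * c * deriv h (K 0)) (at 0)"
    by (rule DERIV_mult[OF DERIV_chain2[OF _ dK[OF zero(1)]] dK'])
       (use K0 in \<open>simp add: holomorphic_derivI[OF holomorphic_deriv[OF hol opU] opU zero(2)]\<close>)
  moreover have "eventually (\<lambda>w. deriv H w = deriv h (K w) * K' w) (nhds 0)"
    using eventually_nhds_in_open[OF open_ball zero(1)]
    by (rule eventually_mono) (use DERIV_imp_deriv[OF dH] in auto)
  ultimately have "(deriv H has_field_derivative
      deriv (deriv h) (K 0) * K' 0 * K' 0 + 16 * c * deriv h (K 0)) (at 0)"
    by (simp add: DERIV_cong_ev)
  then have d2: "deriv (deriv H) 0 = 16 * c\<^sup>2 * deriv (deriv h) 0 + 16 * c * deriv h 0"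
    using K0 by (simp add: DERIV_imp_deriv power2_eq_square)
  have "2 * Re (deriv H 0) - Re (deriv (deriv H) 0) / 2 = - 8 * c\<^sup>2 * Re (deriv (deriv h) 0)"
    unfolding d1 d2 by (simp flip: of_real_power add: algebra_simps)
  then show ?thesis using main c by (simp add: zero_le_mult_iff)
qed

section \<open>The barrier argument\<close>

lemma block_line: "(\<lambda>a. cx x a + t * cx (\<lambda>a. of_bool (a \<in> K)) a) = (\<lambda>a. cx x a + t * of_bool (a \<in> K))"
  by (auto simp: cx_def)

text \<open>Along the block \<open>K\<close>, the barrier is a function of one complex parameter \<open>t\<close>. It has no poles off the
  real axis by \<open>stable_block_nonzero\<close>, and none at positive \<open>t\<close> because \<open>x\<close> is above the zeros.
  So around \<open>t\<^sub>0\<close> it is holomorphic on a plane slit from \<open>t\<^sub>0\<close> downwards by \<open>c = t\<^sub>0\<close>.\<close>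

lemma barrier_block_convex:
  fixes J :: "'a set"
  assumes P: "real_stable P" and ab: "above_zeros P x" and fin: "finite K" and t0: "t0 > 0"
  defines "h \<equiv> \<lambda>t. barrier J P (\<lambda>a. cx x a + t * of_bool (a \<in> K))"
  shows "Re (deriv (deriv h) (of_real t0)) \<ge> 0"
    and "(deriv h has_field_derivative deriv (deriv h) (of_real t0)) (at (of_real t0))"
proof -
  note Ps = real_stableD[OF P]
  define U where "U = {t :: complex. Im t \<noteq> 0 \<or> Re t > 0}"
  have sym: "Q (\<lambda>a. cx x a + cnj t * of_bool (a \<in> K)) = cnj (Q (\<lambda>a. cx x a + t * of_bool (a \<in> K)))"
    if "real_multiaffine Q" for Q t
    unfolding multiaffine_cnj[OF that, symmetric] by (auto simp: cx_def intro!: arg_cong[of _ _ Q])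
  have nz_up: "P (\<lambda>a. cx x a + t * of_bool (a \<in> K)) \<noteq> 0" if "Im t > 0" for t
    by (rule stable_block_nonzero[OF Ps _ above_zeros_nonzero[OF ab order_refl] that fin]) (simp add: cx_def)
  have nz: "P (\<lambda>a. cx x a + t * of_bool (a \<in> K)) \<noteq> 0" if "t \<in> U" for t
  proof (cases "Im t" "0 :: real" rule: linorder_cases)
    case less
    then have "Im (cnj t) > 0" by simp
    from nz_up[OF this] show ?thesis unfolding sym[OF Ps(1)] by simp
  next
    case equal
    then have "t = of_real (Re t)" "Re t > 0" using that by (auto simp: complex_eq_iff U_def)
    moreover have "P (cx (\<lambda>a. x a + Re t * of_bool (a \<in> K))) \<noteq> 0"
      by (rule above_zeros_nonzero[OF ab]) (use \<open>Re t > 0\<close> in \<open>simp add: le_fun_def\<close>)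
    ultimately show ?thesis unfolding cx_line block_line by metis
  qed (rule nz_up)
  have opU: "open U"
  proof -
    have "U = {t. Im t > 0} \<union> {t. Im t < 0} \<union> {t. Re t > 0}" by (auto simp: U_def)
    then show ?thesis
      by (simp add: open_Un open_halfspace_Im_gt open_halfspace_Im_lt open_halfspace_Re_gt)
  qed
  have hol: "h holomorphic_on U"
    unfolding h_def barrier_def using nz
    by (intro holomorphic_on_divide holomorphic_on_sum multiaffine_holomorphic real_multiaffine_partial Ps) auto
  have t0U: "of_real t0 \<in> U" using t0 by (simp add: U_def)
  show "(deriv h has_field_derivative deriv (deriv h) (of_real t0)) (at (of_real t0))"
    by (rule holomorphic_derivI[OF holomorphic_deriv[OF hol opU] opU t0U])
  define g where "g = (\<lambda>t. h (t + of_real t0))"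
  have "Re (deriv (deriv g) 0) \<ge> 0"
  proof (rule second_deriv_nonneg_slit[OF t0])
    show "g holomorphic_on {t. Im t \<noteq> 0 \<or> Re t > - t0}"
      unfolding g_def
      by (rule holomorphic_on_compose_gen[OF _ hol, unfolded o_def])
         (auto intro!: holomorphic_intros simp: U_def)
  next
    fix t assume "Im t > 0"
    then show "Im (g t) \<le> 0"
      unfolding g_def h_def by (intro Im_barrier_nonpos_closed[OF P]) (simp add: cx_def)
  next
    fix t
    have "cnj t + of_real t0 = cnj (t + of_real t0)" by simp
    then show "g (cnj t) = cnj (g t)"
      unfolding g_def h_def barrier_def by (simp only: sym[OF Ps(1)] sym[OF real_multiaffine_partial[OF Ps(1)]]
          complex_cnj_divide cnj_sum)
  qed
  moreover have shift: "deriv (\<lambda>t. f (t + c)) = (\<lambda>t. deriv f (t + c))" for f and c :: complex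
    by (rule ext) (simp add: deriv_def DERIV_shift)
  ultimately show "Re (deriv (deriv h) (of_real t0)) \<ge> 0"
    by (simp add: g_def shift)
qed

lemma sum_partial_one_minus_partials:
  "(\<Sum>a\<in>J. partial a (one_minus_partials K P) w)
     = (\<Sum>a\<in>J. partial a P w) - (\<Sum>b\<in>K. \<Sum>a\<in>J. partial b (partial a P) w)"
proof -
  have "partial a (one_minus_partials K P) w = partial a P w - (\<Sum>b\<in>K. partial a (partial b P) w)" for a
    by (simp add: partial_def[of a] one_minus_partials_def sum_subtractf)
  then have "(\<Sum>a\<in>J. partial a (one_minus_partials K P) w)
     = (\<Sum>a\<in>J. partial a P w) - (\<Sum>a\<in>J. \<Sum>b\<in>K. partial a (partial b P) w)"
    by (simp add: sum_subtractf)
  also have "(\<Sum>a\<in>J. \<Sum>b\<in>K. partial a (partial b P) w) = (\<Sum>b\<in>K. \<Sum>a\<in>J. partial b (partial a P) w)"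
    by (subst sum.swap) (intro sum.cong refl partial_commute)
  finally show ?thesis .
qed

text \<open>With \<open>\<phi>\<^sub>J\<close>, \<open>\<phi>\<^sub>K\<close> for the barriers of \<open>P\<close>, the new function is \<open>P (1 - \<phi>\<^sub>K)\<close>, and the logarithmic
  derivative of \<open>1 - \<phi>\<^sub>K\<close> in direction \<open>J\<close> is expressed through the derivative of \<open>\<phi>\<^sub>J\<close> in direction \<open>K\<close>,
  by symmetry of the second derivatives.\<close>

lemma barrier_one_minus_partials:
  assumes P: "real_multiaffine P" and fin: "finite K"
    and nz: "P (\<lambda>a. w a + t * of_bool (a \<in> K)) \<noteq> 0"
    and ne: "barrier K P (\<lambda>a. w a + t * of_bool (a \<in> K)) \<noteq> 1"
  defines "v \<equiv> \<lambda>a. w a + t * of_bool (a \<in> K)"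
  shows "barrier J (one_minus_partials K P) v
     = barrier J P v - deriv (\<lambda>t. barrier J P (\<lambda>a. w a + t * of_bool (a \<in> K))) t / (1 - barrier K P v)"
proof -
  define p i j ij where "p = P v" and "i = (\<Sum>a\<in>J. partial a P v)" and "j = (\<Sum>b\<in>K. partial b P v)"
    and "ij = (\<Sum>b\<in>K. \<Sum>a\<in>J. partial b (partial a P) v)"
  have p: "p \<noteq> 0" using nz by (simp add: p_def v_def)
  have pj: "p - j \<noteq> 0" using ne p by (auto simp: barrier_def j_def p_def v_def)
  have "((\<lambda>t. barrier J P (\<lambda>a. w a + t * of_bool (a \<in> K))) has_field_derivative (ij * p - i * j) / (p * p)) (at t)"
  proof -
    have dJ: "((\<lambda>t. \<Sum>a\<in>J. partial a P (\<lambda>a. w a + t * of_bool (a \<in> K))) has_field_derivative ij) (at t)"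
      unfolding ij_def v_def
      by (subst sum.swap) (intro DERIV_sum has_derivative_block fin real_multiaffine_partial P)
    have dP: "((\<lambda>t. P (\<lambda>a. w a + t * of_bool (a \<in> K))) has_field_derivative j) (at t)"
      unfolding j_def v_def by (intro has_derivative_block fin P)
    show ?thesis
      unfolding barrier_def using DERIV_divide[OF dJ dP nz] by (simp add: p_def i_def v_def)
  qed
  then have d: "deriv (\<lambda>t. barrier J P (\<lambda>a. w a + t * of_bool (a \<in> K))) t = (ij * p - i * j) / (p * p)"
    by (rule DERIV_imp_deriv)
  have "barrier J (one_minus_partials K P) v = (i - ij) / (p - j)"
    unfolding barrier_def sum_partial_one_minus_partials one_minus_partials_def
    by (simp add: p_def i_def j_def ij_def)
  moreover have "barrier J P v = i / p" "barrier K P v = j / p"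
    by (simp_all add: barrier_def p_def i_def j_def)
  moreover have "(i - ij) / (p - j) = i / p - ((ij * p - i * j) / (p * p)) / (1 - j / p)"
  proof -
    have "1 - j / p = (p - j) / p" using p by (simp add: diff_divide_distrib)
    then have "((ij * p - i * j) / (p * p)) / (1 - j / p) = (ij * p - i * j) / (p * (p - j))"
      using p by simp
    also have "i / p - \<dots> = (i * (p - j) - (ij * p - i * j)) / (p * (p - j))"
      using p pj by (simp add: diff_divide_distrib)
    also have "i * (p - j) - (ij * p - i * j) = p * (i - ij)" by (simp add: algebra_simps)
    finally show ?thesis using p by simp
  qed
  ultimately show ?thesis unfolding d by simp
qed

text \<open>Applying the average costs \<open>- f'(s) / (1 - \<phi>\<^sub>K)\<close> with \<open>f\<close> the barrier along the move, and
  \<open>1 / (1 - \<phi>\<^sub>K) \<le> s\<close>. Moving up by \<open>s\<close> gains \<open>f(0) - f(s)\<close>, which is at least \<open>- s f'(s)\<close> by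
  convexity.\<close>

lemma barrier_step:
  assumes P: "real_stable P" and ab: "above_zeros P x" and fin: "finite K" and s: "s > 0"
    and bound: "Re (barrier K P (cx x)) \<le> 1 - 1 / s"
  defines "x' \<equiv> \<lambda>a. x a + s * of_bool (a \<in> K)"
  shows "above_zeros (one_minus_partials K P) x'"
    and "Re (barrier J (one_minus_partials K P) (cx x')) \<le> Re (barrier J P (cx x))"
proof -
  note ma = real_stableD(1)[OF P]
  have xx': "x \<le> x'" using s by (simp add: x'_def le_fun_def)
  have "1 / s > 0" using s by simp
  then have "Re (barrier K P (cx x)) < 1" using bound by linarith
  then show "above_zeros (one_minus_partials K P) x'"
    by (intro above_zeros_mono[OF above_one_minus_partials[OF P ab] xx'])
  define h where "h = (\<lambda>t. barrier J P (\<lambda>a. cx x a + t * of_bool (a \<in> K)))"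
  define f where "f = (\<lambda>\<theta>. Re (h (of_real \<theta>)))"
  define f' where "f' = (\<lambda>\<theta>. Re (deriv h (of_real \<theta>)))"
  have line: "cx (\<lambda>a. x a + \<theta> * of_bool (a \<in> K)) = (\<lambda>a. cx x a + of_real \<theta> * of_bool (a \<in> K))" for \<theta>
    by (auto simp: cx_def)
  have f01: "f 0 = Re (barrier J P (cx x))" "f s = Re (barrier J P (cx x'))"
    unfolding f_def h_def line[symmetric] x'_def by simp_all
  have nz: "P (cx (\<lambda>a. x a + \<theta> * of_bool (a \<in> K))) \<noteq> 0" if "\<theta> \<ge> 0" for \<theta>
    using that by (intro above_zeros_nonzero[OF ab]) (simp add: le_fun_def)
  have df: "(f has_real_derivative f' \<theta>) (at \<theta>)" and f'le: "f' \<theta> \<le> 0" if "\<theta> \<ge> 0" for \<theta>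
    using barrier_line_deriv_nonpos[OF P _ nz[OF that], of J, unfolded block_line, folded h_def] DERIV_Re_of_real
    unfolding f_def f'_def by auto
  obtain z where z: "0 < z" "z < s" "f s - f 0 = (s - 0) * f' z"
    using MVT2[OF s df] by auto
  have "f' z \<le> f' s"
  proof (rule DERIV_nonneg_imp_nondecreasing[of z s f'])
    fix \<theta> assume "z \<le> \<theta>" "\<theta> \<le> s"
    then have "\<theta> > 0" using z by simp
    from barrier_block_convex[OF P ab fin this, of J, folded h_def]
    show "\<exists>y. (f' has_real_derivative y) (at \<theta>) \<and> y \<ge> 0"
      unfolding f'_def using DERIV_Re_of_real by blast
  qed (use z in simp)
  then have convex: "f s - f 0 \<le> s * f' s" using z s by simp
  define c where "c = 1 - Re (barrier K P (cx x'))"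
  have "Re (barrier K P (cx x')) \<le> Re (barrier K P (cx x))"
    by (rule above_barrier_antimono[OF P ab xx'])
  then have c: "c \<ge> 1 / s" using bound by (simp add: c_def)
  then have cpos: "c > 0" using \<open>1 / s > 0\<close> by linarith
  have bK: "barrier K P (cx x') = of_real (1 - c)"
    unfolding c_def Re_barrier_cx[OF ma] barrier_cx[OF ma] by simp
  have "barrier J (one_minus_partials K P) (cx x') = barrier J P (cx x') - deriv h (of_real s) / (1 - barrier K P (cx x'))"
    unfolding x'_def line h_def
    by (rule barrier_one_minus_partials[OF ma fin])
       (use nz[of s] bK cpos s in \<open>auto simp: line x'_def\<close>)
  also have "Re \<dots> = f s - f' s / c"
    unfolding bK f01(2) f'_def by (simp add: Re_divide_of_real)
  finally have "Re (barrier J (one_minus_partials K P) (cx x')) = f s - f' s / c" .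
  also have "\<dots> \<le> f s - s * f' s"
  proof -
    have "1 / c \<le> s" using c cpos s by (simp add: field_simps)
    then have "(- f' s) * (1 / c) \<le> (- f' s) * s"
      using f'le[of s] s by (intro mult_left_mono) auto
    then show ?thesis by (simp add: mult.commute)
  qed
  also have "\<dots> \<le> f 0" using convex by simp
  finally show "Re (barrier J (one_minus_partials K P) (cx x')) \<le> Re (barrier J P (cx x))" by (simp add: f01)
qed

lemma above_iterated_minus_partials:
  assumes P: "real_stable P" and ab: "above_zeros P x" and fin: "\<And>i. finite (K i)" and s: "s > 0"
    and disj: "\<And>i j. i \<noteq> j \<Longrightarrow> K i \<inter> K j = {}"
    and bound: "\<And>i. Re (barrier (K i) P (cx x)) \<le> 1 - 1 / s"
  shows "above_zeros (iterated_minus_partials K n P) (\<lambda>a. x a + s * of_bool (a \<in> (\<Union>i<n. K i)))"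
proof -
  let ?x = "\<lambda>n a. x a + s * of_bool (a \<in> (\<Union>i<n. K i))"
  have "above_zeros (iterated_minus_partials K n P) (?x n) \<and>
    (\<forall>i. Re (barrier (K i) (iterated_minus_partials K n P) (cx (?x n))) \<le> 1 - 1 / s)"
  proof (induction n)
    case 0
    then show ?case using ab bound by simp
  next
    case (Suc n)
    note step = barrier_step[OF real_stable_iterated[OF P] Suc.IH[THEN conjunct1] fin s
        Suc.IH[THEN conjunct2, rule_format]]
    have eq: "(\<lambda>a. ?x n a + s * of_bool (a \<in> K n)) = ?x (Suc n)"
    proof
      fix a
      have "a \<notin> K i" if "a \<in> K n" "i < n" for i
        using disj[of i n] that by blast
      then show "?x n a + s * of_bool (a \<in> K n) = ?x (Suc n) a" by (auto simp: lessThan_Suc)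
    qed
    show ?case
    proof (intro conjI allI)
      show "above_zeros (iterated_minus_partials K (Suc n) P) (?x (Suc n))"
        using step(1)[of n] unfolding eq iterated_minus_partials.simps .
    next
      fix i
      show "Re (barrier (K i) (iterated_minus_partials K (Suc n) P) (cx (?x (Suc n)))) \<le> 1 - 1 / s"
        using order_trans[OF step(2)[of "K i" n] Suc.IH[THEN conjunct2, rule_format, of i]]
        unfolding eq iterated_minus_partials.simps .
    qed
  qed
  then show ?thesis by blast
qed

section \<open>Determinants and quadratic forms\<close>

text \<open>The sesquilinear form \<open>x\<^sup>* y\<close>; its real part is the library's inner product on \<open>complex^'n\<close>.\<close>

definition hdot :: "complex^'n \<Rightarrow> complex^'n \<Rightarrow> complex" where
  "hdot x y = (\<Sum>a\<in>UNIV. cnj (x $ a) * y $ a)"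

lemma hdot_add: "hdot x (y + z) = hdot x y + hdot x z"
  by (simp add: hdot_def algebra_simps sum.distrib)

lemma hdot_sum: "hdot x (\<Sum>i\<in>I. f i) = (\<Sum>i\<in>I. hdot x (f i))"
  unfolding hdot_def by (simp add: sum_distrib_left) (rule sum.swap)

lemma hdot_scale: "hdot x (c *s y) = c * hdot x y"
  by (simp add: hdot_def sum_distrib_left mult_ac)

lemma cnj_hdot: "cnj (hdot x y) = hdot y x"
  by (simp add: hdot_def mult.commute)

lemma Re_hdot: "Re (hdot x y) = inner x y"
  by (simp add: hdot_def inner_vec_def inner_complex_def)

lemma hdot_self: "hdot x x = of_real ((norm x)\<^sup>2)"
proof -
  have "Im (hdot x x) = 0" using cnj_hdot[of x x] by (simp add: complex_eq_iff)
  then show ?thesis by (simp add: complex_eq_iff Re_hdot power2_norm_eq_inner)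
qed

lemma cmod_hdot_le: "cmod (hdot x y) \<le> norm x * norm y"
proof -
  have "cmod (hdot x y) \<le> (\<Sum>a\<in>UNIV. \<bar>cmod (x $ a)\<bar> * \<bar>cmod (y $ a)\<bar>)"
    unfolding hdot_def by (rule order_trans[OF norm_sum]) (simp add: norm_mult)
  also have "\<dots> \<le> L2_set (\<lambda>a. cmod (x $ a)) UNIV * L2_set (\<lambda>a. cmod (y $ a)) UNIV"
    by (rule L2_set_mult_ineq)
  finally show ?thesis by (simp add: norm_vec_def)
qed

lemma hdot_matrix: "hdot x (M *v y) = (\<Sum>a\<in>UNIV. \<Sum>b\<in>UNIV. cnj (x $ a) * M $ a $ b * y $ b)"
  by (simp add: hdot_def matrix_vector_mult_def sum_distrib_left mult_ac)

lemma hermitian_entry: "hermitian M \<Longrightarrow> cnj (M $ a $ b) = M $ b $ a"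
  by (auto simp: hermitian_def conj_transpose_def vec_eq_iff)

lemma hermitianI: "(\<And>a b. cnj (M $ a $ b) = M $ b $ a) \<Longrightarrow> hermitian M"
  by (auto simp: hermitian_def conj_transpose_def vec_eq_iff)

lemma outer_self_mult: "outer_self u *v x = hdot u x *s u"
  by (simp add: vec_eq_iff outer_self_def matrix_vector_mult_def hdot_def sum_distrib_left
      sum_distrib_right mult_ac)

lemma sum_matrix_mult: "(\<Sum>i\<in>I. A i) *v x = (\<Sum>i\<in>I. A i *v x)"
  by (induction I rule: infinite_finite_induct) (simp_all add: matrix_vector_mult_add_rdistrib)

lemma hdot_sum_outer:
  "hdot y ((\<Sum>i\<in>I. outer_self (u i)) *v x) = (\<Sum>i\<in>I. cnj (hdot (u i) y) * hdot (u i) x)"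
  by (simp add: sum_matrix_mult hdot_sum outer_self_mult hdot_scale cnj_hdot mult.commute)

lemma hermitian_sum_outer: "hermitian (\<Sum>i\<in>I. outer_self (u i))"
  by (rule hermitianI) (simp add: outer_self_def mult.commute)

text \<open>Once some row is \<open>v\<close> itself, row operations remove the multiples of \<open>v\<close> from the other rows.\<close>

lemma det_row_shear_keep:
  fixes M :: "'a::comm_ring_1^'n^'n"
  assumes "finite S" "k \<notin> S"
  shows "det (\<chi> a. if a = k then v else if a \<in> S then M $ a + d a *s v else M $ a)
       = det (\<chi> a. if a = k then v else M $ a)"
  using assms
proof (induction S)
  case (insert b S)
  define A where "A = (\<chi> a. if a = k then v else if a \<in> S then M $ a + d a *s v else M $ a)"
  have bk: "b \<noteq> k" using insert.prems by auto
  have "(\<chi> a. if a = k then v else if a \<in> insert b S then M $ a + d a *s v else M $ a)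
      = (\<chi> a. if a = b then row b A + d b *s row k A else row a A)"
    using insert.hyps bk by (auto simp: A_def row_def vec_eq_iff)
  also have "det \<dots> = det A" by (rule det_row_operation[OF bk])
  finally show ?case using insert by (simp add: A_def)
qed (simp cong: if_cong)

text \<open>Expanding the rank-one perturbation row by row, every term with two perturbed rows vanishes, so only
  the terms of degree at most one in \<open>t\<close> remain.\<close>

lemma det_rank_one_rows:
  fixes M :: "'a::comm_ring_1^'n^'n"
  assumes "finite S"
  shows "det (\<chi> a. if a \<in> S then M $ a + (t * c a) *s v else M $ a)
       = det M + t * (\<Sum>a\<in>S. c a * det (\<chi> a'. if a' = a then v else M $ a'))"
  using assms
proof (induction S)
  case empty
  then show ?case by simp
next
  case (insert b S)
  define N where "N = (\<lambda>a. if a \<in> S then M $ a + (t * c a) *s v else M $ a)"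
  have "(\<chi> a. if a \<in> insert b S then M $ a + (t * c a) *s v else M $ a)
     = (\<chi> a. if a = b then M $ b + (t * c b) *s v else N a)"
    using insert.hyps by (auto simp: N_def vec_eq_iff)
  also have "det \<dots> = det (\<chi> a. if a = b then M $ b else N a) + (t * c b) * det (\<chi> a. if a = b then v else N a)"
    unfolding det_row_add det_row_mul ..
  also have "(\<chi> a. if a = b then M $ b else N a) = (\<chi> a. if a \<in> S then M $ a + (t * c a) *s v else M $ a)"
    using insert.hyps by (auto simp: N_def vec_eq_iff)
  also have "det (\<chi> a. if a = b then v else N a) = det (\<chi> a. if a = b then v else M $ a)"
    unfolding N_def by (rule det_row_shear_keep[OF insert.hyps])
  finally show ?case using insert by (simp add: algebra_simps)
qed

lemma det_rank_one_affine:
  fixes M :: "'a::comm_ring_1^'n^'n"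
  shows "\<exists>\<beta>. \<forall>t. det (\<chi> a b. M $ a $ b + t * (c a * d b)) = det M + t * \<beta>"
proof (intro exI allI)
  fix t
  have "(\<chi> a b. M $ a $ b + t * (c a * d b))
     = (\<chi> a. if a \<in> UNIV then M $ a + (t * c a) *s (\<chi> b. d b) else M $ a)"
    by (simp add: vec_eq_iff mult.assoc)
  then show "det (\<chi> a b. M $ a $ b + t * (c a * d b))
      = det M + t * (\<Sum>a\<in>UNIV. c a * det (\<chi> a'. if a' = a then (\<chi> b. d b) else M $ a'))"
    by (simp only: det_rank_one_rows[OF finite])
qed

lemma det_nonzero_iff_kernel:
  fixes M :: "'a::field^'n^'n"
  shows "det M \<noteq> 0 \<longleftrightarrow> (\<forall>x. M *v x = 0 \<longrightarrow> x = 0)"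
  by (simp add: invertible_det_nz[symmetric] invertible_left_inverse matrix_left_invertible_ker)

lemma det_conj:
  fixes M :: "complex^'n^'n"
  shows "det (\<chi> a b. cnj (M $ a $ b)) = cnj (det M)"
  by (simp add: det_def)

lemma det_hermitian_real:
  assumes "hermitian M"
  shows "Im (det M) = 0"
proof -
  have "(\<chi> a b. cnj (M $ a $ b)) = transpose M"
    by (simp add: transpose_def hermitian_entry[OF assms])
  then have "cnj (det M) = det M" using det_conj[of M] by (simp add: det_transpose)
  then show ?thesis by (simp add: complex_eq_iff)
qed

text \<open>On the segment from the identity to \<open>M\<close> all matrices are positive definite, so the determinant, which
  is real and equals 1 at the start, never vanishes.\<close>

lemma det_pos_of_definite:
  assumes M: "hermitian M" and pd: "\<And>x. x \<noteq> 0 \<Longrightarrow> Re (hdot x (M *v x)) > 0"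
  shows "Re (det M) > 0"
proof (rule ccontr)
  assume neg: "\<not> ?thesis"
  define N :: "real \<Rightarrow> complex^'a^'a" where
    "N = (\<lambda>s. \<chi> a b. of_real (1 - s) * mat 1 $ a $ b + of_real s * M $ a $ b)"
  have form: "hdot x (N s *v x) = of_real (1 - s) * hdot x x + of_real s * hdot x (M *v x)" for s x
  proof -
    have "N s *v x = of_real (1 - s) *s (mat 1 *v x) + of_real s *s (M *v x)"
      unfolding N_def
      by (simp add: vec_eq_iff matrix_vector_mult_def sum.distrib sum_subtractf sum_distrib_left algebra_simps)
    then show ?thesis by (simp only: hdot_add hdot_scale matrix_vector_mul_lid)
  qed
  have "continuous_on {0..1} (\<lambda>s. Re (det (N s)))"
    unfolding N_def det_def by (intro continuous_intros)
  moreover have "N 0 = mat 1" "N 1 = M" by (simp_all add: N_def vec_eq_iff)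
  ultimately obtain s where s: "0 \<le> s" "s \<le> 1" "Re (det (N s)) = 0"
    using IVT2'[of "\<lambda>s. Re (det (N s))" 1 0 0] neg by auto
  have "hermitian (N s)"
    by (rule hermitianI) (auto simp: N_def hermitian_entry[OF M] mat_def)
  then have "det (N s) = 0" using s(3) det_hermitian_real by (simp add: complex_eq_iff)
  then obtain x where x: "N s *v x = 0" "x \<noteq> 0" using det_nonzero_iff_kernel by blast
  have "Re (hdot x (N s *v x)) = (1 - s) * (norm x)\<^sup>2 + s * Re (hdot x (M *v x))"
    unfolding form hdot_self by simp
  moreover have "hdot x (N s *v x) = 0" unfolding x(1) by (simp add: hdot_def)
  moreover have "(1 - s) * (norm x)\<^sup>2 + s * Re (hdot x (M *v x)) > 0"
    using s pd[OF x(2)] x(2)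
    by (cases "s = 0") (auto intro: add_nonneg_pos)
  ultimately show False by simp
qed

lemma hermitian_adjoint:
  assumes "hermitian N"
  shows "inner x (N *v y) = inner (N *v x) y"
proof -
  have "hdot x (N *v y) = cnj (hdot y (N *v x))"
    unfolding hdot_matrix by (subst sum.swap) (simp add: hermitian_entry[OF assms] mult_ac)
  then show ?thesis by (metis Re_hdot complex_cnj_cnj cnj.simps(1) inner_commute)
qed

lemma matrix_mult_scaleR: "(N :: complex^'n^'m) *v (c *\<^sub>R x) = c *\<^sub>R (N *v x)"
  by (simp add: vec_eq_iff matrix_vector_mult_def scaleR_sum_right)

text \<open>Here \<open>ns\<close> says that \<open>R I - \<theta> N\<close> is nonsingular for \<open>\<theta> \<in> [0, 1]\<close>. The maximum \<open>m\<close> of the form on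
  the unit sphere is an eigenvalue of \<open>N\<close>: at a maximiser \<open>v\<close>, the form of \<open>m I - N\<close> is zero while being
  nonnegative everywhere, so \<open>v\<close> is in the kernel. If \<open>m > R\<close> then \<open>\<theta> = R / m\<close> contradicts \<open>ns\<close>.\<close>

lemma form_le_of_nonsingular_ray:
  fixes N :: "complex^'n^'n"
  assumes N: "hermitian N" and R: "R > 0"
    and ns: "\<And>\<theta> x. 0 \<le> \<theta> \<Longrightarrow> \<theta> \<le> 1 \<Longrightarrow> R *\<^sub>R x = \<theta> *\<^sub>R (N *v x) \<Longrightarrow> x = 0"
  shows "inner x (N *v x) \<le> R * (norm x)\<^sup>2"
proof -
  define f where "f = (\<lambda>x. inner x (N *v x))"
  have "continuous_on UNIV (\<lambda>x. N *v x)"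
    unfolding matrix_vector_mult_def
    by (intro continuous_on_vec_lambda continuous_intros)
  then have "continuous_on (sphere 0 1) f"
    unfolding f_def by (intro continuous_on_inner continuous_on_id) (auto intro: continuous_on_subset)
  moreover have "axis undefined 1 \<in> sphere (0 :: complex^'n) 1" by simp
  ultimately obtain v where v: "norm v = 1" "\<And>x. norm x = 1 \<Longrightarrow> f x \<le> f v"
    using continuous_attains_sup[of "sphere (0 :: complex^'n) 1" f] by (auto simp: compact_sphere)
  define m where "m = f v"
  have le: "f x \<le> m * (norm x)\<^sup>2" for x
  proof (cases "x = 0")
    case False
    have "f ((1 / norm x) *\<^sub>R x) = f x / (norm x)\<^sup>2"
      by (simp add: f_def matrix_mult_scaleR power2_eq_square)
    moreover have "f ((1 / norm x) *\<^sub>R x) \<le> m" using False by (simp add: m_def v)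
    ultimately show ?thesis using False by (simp add: divide_le_eq)
  qed (simp add: f_def)
  have "m \<le> R"
  proof (rule ccontr)
    assume "\<not> m \<le> R"
    then have mR: "m > R" "m > 0" using R by auto
    define y where "y = m *\<^sub>R v - N *v v"
    define q where "q = m * (norm y)\<^sup>2 - f y"
    have ineq: "2 * s * (norm y)\<^sup>2 \<le> s\<^sup>2 * q" for s
    proof -
      have "f (v - s *\<^sub>R y) \<le> m * (norm (v - s *\<^sub>R y))\<^sup>2" by (rule le)
      moreover have "f (v - s *\<^sub>R y) = f v - 2 * s * inner (N *v v) y + s\<^sup>2 * f y"
        unfolding f_def
        by (simp add: matrix_vector_mult_diff_distrib matrix_mult_scaleR inner_diff_left inner_diff_right
            hermitian_adjoint[OF N, of v y] inner_commute[of y "N *v v"] power2_eq_square algebra_simps)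
      moreover have "(norm (v - s *\<^sub>R y))\<^sup>2 = 1 - 2 * s * inner v y + s\<^sup>2 * (norm y)\<^sup>2"
        using v(1) unfolding power2_norm_eq_inner
        by (simp add: inner_diff_left inner_diff_right inner_commute[of y v] power2_eq_square
            norm_eq_1 algebra_simps)
      ultimately have "f v - 2 * s * inner (N *v v) y + s\<^sup>2 * f y
          \<le> m - 2 * s * (m * inner v y) + s\<^sup>2 * (m * (norm y)\<^sup>2)" by (simp add: algebra_simps)
      moreover have "(norm y)\<^sup>2 = m * inner v y - inner (N *v v) y"
        unfolding power2_norm_eq_inner by (subst (1) y_def) (simp add: inner_diff_left)
      then have "2 * s * (norm y)\<^sup>2 = 2 * s * (m * inner v y) - 2 * s * inner (N *v v) y"
        by (simp only: right_diff_distrib)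
      ultimately show ?thesis unfolding q_def m_def[symmetric] right_diff_distrib by linarith
    qed
    have "norm y = 0"
    proof (rule ccontr)
      assume "norm y \<noteq> 0"
      then have y: "(norm y)\<^sup>2 > 0" by simp
      have "2 * (norm y)\<^sup>2 \<le> q" using ineq[of 1] by simp
      then have q: "q > 0" using y by linarith
      have "2 * ((norm y)\<^sup>2 / q) * (norm y)\<^sup>2 \<le> ((norm y)\<^sup>2 / q)\<^sup>2 * q" by (rule ineq)
      then have "2 * ((norm y)\<^sup>2)\<^sup>2 \<le> ((norm y)\<^sup>2)\<^sup>2"
        using q by (simp add: power2_eq_square field_simps)
      then show False using y by (simp add: mult_le_0_iff)
    qed
    then have "N *v v = m *\<^sub>R v" by (simp add: y_def)
    then have "R *\<^sub>R v = (R / m) *\<^sub>R (N *v v)" using mR by simp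
    then have "v = 0" by (intro ns[of "R / m"]) (use mR R in auto)
    then show False using v(1) by simp
  qed
  then show ?thesis using le[of x] unfolding f_def
    by (meson mult_right_mono order_trans zero_le_power2)
qed

text \<open>Writing \<open>y = A x\<close>, the Cauchy-Schwarz inequality for the form of \<open>A\<close> bounds \<open>\<parallel>y\<parallel>\<^sup>4 = \<bar>y\<^sup>* A x\<bar>\<^sup>2\<close> by
  \<open>(y\<^sup>* A y) (x\<^sup>* A x)\<close>.\<close>

lemma spectral_norm_le_of_form:
  fixes u :: "'i \<Rightarrow> complex^'n" and S :: "'i set"
  defines "A \<equiv> \<Sum>i\<in>S. outer_self (u i)"
  assumes c: "c \<ge> 0" and form: "\<And>x. inner x (A *v x) \<le> c * (norm x)\<^sup>2"
  shows "spectral_norm A \<le> c"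
  unfolding spectral_norm_def
proof (rule onorm_bound[OF c])
  fix x
  have sq: "(\<Sum>i\<in>S. (cmod (hdot (u i) z))\<^sup>2) \<le> c * (norm z)\<^sup>2" for z
  proof -
    have "hdot z (A *v z) = of_real (\<Sum>i\<in>S. (cmod (hdot (u i) z))\<^sup>2)"
      unfolding A_def hdot_sum_outer
      by (simp add: complex_norm_square mult.commute flip: of_real_power)
    then show ?thesis using form[of z] by (metis Re_complex_of_real Re_hdot)
  qed
  define y where "y = A *v x"
  have "(norm y)\<^sup>2 = cmod (hdot y (A *v x))" by (simp add: y_def[symmetric] hdot_self norm_power)
  also have "\<dots> \<le> (\<Sum>i\<in>S. cmod (hdot (u i) y) * cmod (hdot (u i) x))"
    unfolding A_def hdot_sum_outer by (rule order_trans[OF norm_sum]) (simp add: norm_mult)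
  finally have "((norm y)\<^sup>2)\<^sup>2 \<le> (\<Sum>i\<in>S. cmod (hdot (u i) y) * cmod (hdot (u i) x))\<^sup>2"
    by (intro power_mono) auto
  also have "\<dots> \<le> (\<Sum>i\<in>S. (cmod (hdot (u i) y))\<^sup>2) * (\<Sum>i\<in>S. (cmod (hdot (u i) x))\<^sup>2)"
    by (rule Cauchy_Schwarz_ineq_sum)
  also have "\<dots> \<le> (c * (norm y)\<^sup>2) * (c * (norm x)\<^sup>2)"
    using c by (intro mult_mono sq sum_nonneg) auto
  finally have "(norm y)\<^sup>2 * (norm y)\<^sup>2 \<le> (norm y)\<^sup>2 * (c * norm x)\<^sup>2"
    by (simp add: power2_eq_square mult_ac)
  then have "(norm y)\<^sup>2 \<le> (c * norm x)\<^sup>2 \<or> y = 0"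
    using mult_le_cancel_left_pos[of "(norm y)\<^sup>2" "(norm y)\<^sup>2" "(c * norm x)\<^sup>2"]
    by (metis zero_less_norm_iff zero_less_power)
  then show "norm (A *v x) \<le> c * norm x"
    using c by (auto simp: y_def[symmetric] dest: power2_le_imp_le)
qed

section \<open>Determinants of pencils of rank-one matrices\<close>

text \<open>The matrix \<open>C + \<Sum>\<^bsub>i\<in>I\<^esub> z\<^sub>i u\<^sub>i u\<^sub>i\<^sup>*\<close>, with an arbitrary constant part \<open>C\<close>. The constant part absorbs
  the defect \<open>I - \<Sum> u\<^sub>i u\<^sub>i\<^sup>*\<close>, so that no vectors have to be added to turn the sum into the identity.\<close>

definition pencil :: "complex^'n^'n \<Rightarrow> ('i \<Rightarrow> complex^'n) \<Rightarrow> 'i set \<Rightarrow> ('i \<Rightarrow> complex) \<Rightarrow> complex^'n^'n" where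
  "pencil C u I z = (\<chi> a b. C $ a $ b + (\<Sum>i\<in>I. z i * (u i $ a * cnj (u i $ b))))"

lemma scaleR_conv_smult: "c *\<^sub>R (v :: complex^'n) = of_real c *s v"
  by (simp add: vec_eq_iff complex_eq_iff)

lemma pencil_mult: "pencil C u I z *v x = C *v x + (\<Sum>i\<in>I. (z i * hdot (u i) x) *s u i)"
proof -
  have "(pencil C u I z *v x) $ a = (C *v x + (\<Sum>i\<in>I. (z i * hdot (u i) x) *s u i)) $ a" for a
  proof -
    have "(\<Sum>b\<in>UNIV. (\<Sum>i\<in>I. z i * (u i $ a * cnj (u i $ b))) * x $ b)
        = (\<Sum>i\<in>I. \<Sum>b\<in>UNIV. z i * (u i $ a * cnj (u i $ b)) * x $ b)"
      by (subst sum.swap) (simp add: sum_distrib_right)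
    also have "\<dots> = (\<Sum>i\<in>I. (z i * hdot (u i) x) * u i $ a)"
      by (simp add: hdot_def sum_distrib_left sum_distrib_right mult_ac)
    finally show ?thesis
      by (simp add: pencil_def matrix_vector_mult_def distrib_right sum.distrib)
  qed
  then show ?thesis by (simp add: vec_eq_iff)
qed

lemma pencil_form:
  "hdot x (pencil C u I z *v x) = hdot x (C *v x) + (\<Sum>i\<in>I. z i * of_real ((cmod (hdot (u i) x))\<^sup>2))"
proof -
  have "z i * hdot (u i) x * hdot x (u i) = z i * of_real ((cmod (hdot (u i) x))\<^sup>2)" for i
    by (simp add: complex_norm_square cnj_hdot mult.assoc del: of_real_power)
  then show ?thesis by (simp only: pencil_mult hdot_add hdot_sum hdot_scale)
qed

lemma hermitian_pencil:
  assumes "hermitian C" "\<And>i. i \<in> I \<Longrightarrow> Im (z i) = 0"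
  shows "hermitian (pencil C u I z)"
proof (rule hermitianI)
  fix a b
  have "cnj (z i) = z i" if "i \<in> I" for i using assms(2)[OF that] by (simp add: complex_eq_iff)
  then show "cnj (pencil C u I z $ a $ b) = pencil C u I z $ b $ a"
    by (simp add: pencil_def hermitian_entry[OF assms(1)] mult_ac cong: sum.cong)
qed

lemma Im_hermitian_form:
  assumes "hermitian C"
  shows "Im (hdot x (C *v x)) = 0"
proof -
  have "cnj (hdot x (C *v x)) = hdot x (C *v x)"
    unfolding hdot_matrix by (subst sum.swap) (simp add: hermitian_entry[OF assms] mult_ac)
  then show ?thesis by (simp add: complex_eq_iff)
qed

text \<open>For a kernel vector \<open>x\<close> of the matrix, the imaginary part of its form is
  \<open>\<Sum> Im z\<^sub>i \<bar>u\<^sub>i\<^sup>* x\<bar>\<^sup>2\<close>, which makes \<open>x\<close> orthogonal to all \<open>u\<^sub>i\<close>.\<close>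

lemma real_stable_det_pencil:
  fixes C :: "complex^'n^'n" and u :: "'i \<Rightarrow> complex^'n"
  assumes C: "hermitian C" and fin: "finite I"
    and nd: "\<And>x. hdot x (C *v x) = 0 \<Longrightarrow> (\<And>i. i \<in> I \<Longrightarrow> hdot (u i) x = 0) \<Longrightarrow> x = 0"
  shows "real_stable (\<lambda>z. det (pencil C u I z))"
proof -
  let ?G = "\<lambda>z. det (pencil C u I z)"
  have "real_multiaffine ?G"
    unfolding real_multiaffine_def
  proof (intro conjI allI)
    fix w :: "'i \<Rightarrow> complex" and i x
    have "\<exists>\<beta>. \<forall>t. ?G (w(i := t)) = ?G (w(i := 0)) + t * \<beta>"
    proof (cases "i \<in> I")
      case True
      define N where "N = pencil C u I (w(i := 0))"
      have "pencil C u I (w(i := t)) = (\<chi> a b. N $ a $ b + t * (u i $ a * cnj (u i $ b)))" for t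
        unfolding N_def pencil_def
        by (simp add: vec_eq_iff sum.remove[OF fin True] cong: if_cong)
      then show ?thesis
        using det_rank_one_affine[of N "\<lambda>a. u i $ a" "\<lambda>b. cnj (u i $ b)"] by (simp add: N_def[symmetric])
    next
      case False
      then have "pencil C u I (w(i := t)) = pencil C u I (w(i := 0))" for t
        unfolding pencil_def by (auto simp: vec_eq_iff intro!: sum.cong)
      then have "\<forall>t. ?G (w(i := t)) = ?G (w(i := 0)) + t * 0" by (metis add.right_neutral mult_zero_right)
      then show ?thesis by blast
    qed
    then obtain \<beta> where \<beta>: "\<And>t. ?G (w(i := t)) = ?G (w(i := 0)) + t * \<beta>" by blast
    have "partial i ?G w = \<beta>" unfolding partial_def using \<beta>[of 1] by simp
    then show "?G (w(i := x)) = ?G (w(i := 0)) + x * partial i ?G w" using \<beta>[of x] by simp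
  next
    fix w :: "'i \<Rightarrow> complex"
    have "pencil C u I (\<lambda>a. cnj (w a)) = transpose (\<chi> a b. cnj (pencil C u I w $ a $ b))"
      by (simp add: pencil_def transpose_def vec_eq_iff hermitian_entry[OF C] mult.commute)
    then show "?G (\<lambda>a. cnj (w a)) = cnj (?G w)" by (simp only: det_transpose det_conj)
  next
    fix w v :: "'i \<Rightarrow> complex"
    show "(\<lambda>t. ?G (\<lambda>a. w a + t * v a)) holomorphic_on UNIV"
      unfolding det_def pencil_def by (simp, intro holomorphic_intros)
  qed
  moreover have "uhp_stable ?G"
    unfolding uhp_stable_def
  proof (intro allI impI)
    fix z :: "'i \<Rightarrow> complex" assume z: "\<forall>a. Im (z a) > 0"
    show "?G z \<noteq> 0"
      unfolding det_nonzero_iff_kernel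
    proof (intro allI impI)
      fix x assume x: "pencil C u I z *v x = 0"
      have eq: "hdot x (C *v x) + (\<Sum>i\<in>I. z i * of_real ((cmod (hdot (u i) x))\<^sup>2)) = 0"
        unfolding pencil_form[symmetric] x by (simp add: hdot_def)
      have "(\<Sum>i\<in>I. Im (z i) * (cmod (hdot (u i) x))\<^sup>2) = 0"
        using arg_cong[OF eq, of Im] by (simp add: Im_hermitian_form[OF C] del: of_real_power)
      then have "\<forall>i\<in>I. Im (z i) * (cmod (hdot (u i) x))\<^sup>2 = 0"
        using z by (subst (asm) sum_nonneg_eq_0_iff[OF fin]) (auto intro!: mult_nonneg_nonneg simp: less_imp_le)
      then have h: "hdot (u i) x = 0" if "i \<in> I" for i
        using z[rule_format, of i] that by force
      then have "hdot x (C *v x) = 0" using eq by simp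
      then show "x = 0" using h by (rule nd)
    qed
  qed
  ultimately show ?thesis by (simp add: real_stable_def)
qed

text \<open>The determinant of a block diagonal matrix with \<open>r\<close> blocks, each with its own set of variables. The
  product form replaces the tensor product \<open>\<complex>\<^sup>d \<otimes> \<complex>\<^sup>r\<close>.\<close>

definition copies :: "nat \<Rightarrow> ((nat \<Rightarrow> complex) \<Rightarrow> complex) \<Rightarrow> (nat \<times> nat \<Rightarrow> complex) \<Rightarrow> complex" where
  "copies r g w = (\<Prod>k\<in>{1..r}. g (\<lambda>i. w (i, k)))"

lemma copies_upd:
  assumes "k \<in> {1..r}"
  shows "copies r g (w((i, k) := x)) = g ((\<lambda>j. w (j, k))(i := x)) * (\<Prod>l\<in>{1..r} - {k}. g (\<lambda>j. w (j, l)))"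
proof -
  have "(\<lambda>j. (w((i, k) := x)) (j, l)) = (if l = k then (\<lambda>j. w (j, k))(i := x) else (\<lambda>j. w (j, l)))" for l
    by auto
  then have "copies r g (w((i, k) := x))
      = (\<Prod>l\<in>{1..r}. g (if l = k then (\<lambda>j. w (j, k))(i := x) else (\<lambda>j. w (j, l))))"
    unfolding copies_def by presburger
  also have "\<dots> = g ((\<lambda>j. w (j, k))(i := x)) * (\<Prod>l\<in>{1..r} - {k}. g (\<lambda>j. w (j, l)))"
    by (subst prod.remove[OF _ assms]) (auto intro!: prod.cong)
  finally show ?thesis .
qed

lemma partial_copies:
  assumes "k \<in> {1..r}"
  shows "partial (i, k) (copies r g) w = partial i g (\<lambda>j. w (j, k)) * (\<Prod>l\<in>{1..r} - {k}. g (\<lambda>j. w (j, l)))"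
  unfolding partial_def copies_upd[OF assms] by (simp add: left_diff_distrib)

lemma real_stable_copies:
  assumes "real_stable g"
  shows "real_stable (copies r g)"
proof -
  note g = real_stableD[OF assms]
  have "real_multiaffine (copies r g)"
    unfolding real_multiaffine_def
  proof (intro conjI allI)
    fix w :: "nat \<times> nat \<Rightarrow> complex" and a :: "nat \<times> nat" and x
    obtain i k where a: "a = (i, k)" by force
    show "copies r g (w(a := x)) = copies r g (w(a := 0)) + x * partial a (copies r g) w"
    proof (cases "k \<in> {1..r}")
      case True
      show ?thesis
        unfolding a copies_upd[OF True] partial_copies[OF True]
        by (subst affine_coord[OF g(1), of _ i x]) (simp add: algebra_simps)
    next
      case False
      have "copies r g (w(a := y)) = copies r g w" for y
        unfolding copies_def a using False
        by (intro prod.cong refl arg_cong[of _ _ g]) (auto simp: fun_eq_iff)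
      then show ?thesis by (simp add: partial_def)
    qed
  qed (auto simp: copies_def multiaffine_cnj[OF g(1)] intro!: holomorphic_on_prod multiaffine_holomorphic[OF g(1)])
  moreover have "uhp_stable (copies r g)"
    using g(2) by (auto simp: uhp_stable_def copies_def)
  ultimately show ?thesis by (simp add: real_stable_def)
qed

lemma Re_copies_cx:
  assumes "real_multiaffine g"
  shows "Re (copies r g (cx y)) = (\<Prod>k\<in>{1..r}. Re (g (cx (\<lambda>i. y (i, k)))))"
proof -
  have "copies r g (cx y) = (\<Prod>k\<in>{1..r}. g (cx (\<lambda>i. y (i, k))))" by (simp add: copies_def cx_def)
  also have "\<dots> = of_real (\<Prod>k\<in>{1..r}. Re (g (cx (\<lambda>i. y (i, k)))))"
    unfolding of_real_prod by (intro prod.cong refl cx_real_value assms)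
  finally show ?thesis by (simp only: Re_complex_of_real)
qed

lemma above_copies:
  assumes "real_multiaffine g" "above_zeros g (\<lambda>_. t)"
  shows "above_zeros (copies r g) (\<lambda>_. t)"
  unfolding above_zeros_def Re_copies_cx[OF assms(1)]
  by (intro allI impI prod_pos above_zerosD[OF assms(2)]) (auto simp: le_fun_def)

lemma barrier_copies:
  assumes nz: "g (cx (\<lambda>_. t)) \<noteq> 0"
  shows "barrier (Pair i ` {1..r}) (copies r g) (cx (\<lambda>_. t)) = of_nat r * (partial i g (cx (\<lambda>_. t)) / g (cx (\<lambda>_. t)))"
proof -
  have c: "(\<lambda>j. cx (\<lambda>_. t) (j, l)) = cx (\<lambda>_. t)" for l :: nat by (auto simp: cx_def)
  have "partial (i, k) (copies r g) (cx (\<lambda>_. t)) / copies r g (cx (\<lambda>_. t))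
      = partial i g (cx (\<lambda>_. t)) / g (cx (\<lambda>_. t))" if k: "k \<in> {1..r}" for k
  proof -
    have "copies r g (cx (\<lambda>_. t)) = g (cx (\<lambda>_. t)) * (\<Prod>l\<in>{1..r} - {k}. g (cx (\<lambda>_. t)))"
      unfolding copies_def c by (rule prod.remove) (use k in auto)
    then show ?thesis using nz unfolding partial_copies[OF k] c by simp
  qed
  then have "(\<Sum>k\<in>{1..r}. partial (i, k) (copies r g) (cx (\<lambda>_. t)) / copies r g (cx (\<lambda>_. t)))
      = (\<Sum>k\<in>{1..r}. partial i g (cx (\<lambda>_. t)) / g (cx (\<lambda>_. t)))"
    by (intro sum.cong refl)
  then show ?thesis
    unfolding barrier_sum by (subst sum.reindex) (auto simp: inj_on_def)
qed

section \<open>Vector partition\<close>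

text \<open>The parameters \<open>t = \<surd>\<epsilon> + \<epsilon>\<close> and \<open>s = 1 + \<surd>\<epsilon>\<close> satisfy \<open>\<epsilon> / t + 1 / s = 1\<close>, the condition for
  starting the barrier argument, and \<open>t + s = R\<close>.\<close>

lemma weaver_partition:
  fixes u :: "nat \<Rightarrow> complex^'n"
  assumes r: "r \<ge> 1" and \<epsilon>: "\<epsilon> > 0"
    and sub: "\<And>x. (\<Sum>i\<in>{1..m}. (cmod (hdot (u i) x))\<^sup>2) \<le> (norm x)\<^sup>2"
    and small: "\<And>i. i \<in> {1..m} \<Longrightarrow> real r * (norm (u i))\<^sup>2 \<le> \<epsilon>"
  shows "\<exists>c. (\<forall>i\<in>{1..m}. c i \<in> {1..r}) \<and> (\<forall>k\<in>{1..r}. \<forall>x.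
    inner x ((\<Sum>i | i \<in> {1..m} \<and> c i = k. outer_self (u i)) *v x) \<le> (1 + sqrt \<epsilon>)\<^sup>2 / r * (norm x)\<^sup>2)"
proof -
  define R t s where "R = (1 + sqrt \<epsilon>)\<^sup>2" and "t = sqrt \<epsilon> + \<epsilon>" and "s = 1 + sqrt \<epsilon>"
  have sq: "sqrt \<epsilon> > 0" "(sqrt \<epsilon>)\<^sup>2 = \<epsilon>" using \<epsilon> by auto
  have R: "R = t + s" "R > 0" "t > 0" "s > 0" "t \<le> R"
    using sq \<epsilon> by (auto simp: R_def t_def s_def power2_eq_square algebra_simps add_pos_pos)
  have rp: "real r > 0" using r by simp
  \<comment> \<open>The coefficient \<open>R\<close> of the defect makes the final matrix \<open>R I\<close> minus the wanted sum,
    and \<open>t \<le> R\<close> makes the initial one at least \<open>t I\<close>.\<close>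
  define C :: "complex^'n^'n" where
    "C = (\<chi> a b. of_real R * (mat 1 - (\<Sum>i\<in>{1..m}. outer_self (u i))) $ a $ b)"
  define h where "h = (\<lambda>i x. (cmod (hdot (u i) x))\<^sup>2)"
  have C_mult: "C *v x = of_real R *s (x - (\<Sum>i\<in>{1..m}. hdot (u i) x *s u i))" for x
  proof -
    have "C *v x = of_real R *s ((mat 1 - (\<Sum>i\<in>{1..m}. outer_self (u i))) *v x)"
      by (simp add: C_def vec_eq_iff matrix_vector_mult_def sum_distrib_left mult_ac)
    then show ?thesis
      by (simp add: matrix_vector_mult_diff_rdistrib sum_matrix_mult outer_self_mult)
  qed
  have C_herm: "hermitian C"
    by (rule hermitianI) (auto simp: C_def mat_def outer_self_def mult.commute)
  have C_form: "hdot x (C *v x) = of_real (R * ((norm x)\<^sup>2 - (\<Sum>i\<in>{1..m}. h i x)))" for x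
  proof -
    have "hdot (u i) x * hdot x (u i) = of_real (h i x)" for i
      by (simp add: h_def complex_norm_square cnj_hdot del: of_real_power)
    then have e: "hdot x x - (\<Sum>i\<in>{1..m}. hdot (u i) x * hdot x (u i))
        = of_real ((norm x)\<^sup>2 - (\<Sum>i\<in>{1..m}. h i x))"
      by (simp only: hdot_self of_real_diff of_real_sum)
    have d: "hdot x (a - b) = hdot x a - hdot x b" for a b
      by (simp add: hdot_def algebra_simps sum_subtractf)
    show ?thesis unfolding C_mult hdot_scale d hdot_sum e of_real_mult ..
  qed
  define g where "g = (\<lambda>z. det (pencil C u {1..m} z))"
  have g: "real_stable g"
    unfolding g_def
  proof (rule real_stable_det_pencil[OF C_herm])
    fix x assume "hdot x (C *v x) = 0" and "\<And>i. i \<in> {1..m} \<Longrightarrow> hdot (u i) x = 0"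
    then have "R * (norm x)\<^sup>2 = 0" unfolding C_form h_def of_real_eq_0_iff by simp
    then show "x = 0" using R by simp
  qed simp
  note gm = real_stableD(1)[OF g]
  have g_pos: "Re (g (cx z)) > 0"
    if "\<And>x. x \<noteq> 0 \<Longrightarrow> R * ((norm x)\<^sup>2 - (\<Sum>i\<in>{1..m}. h i x)) + (\<Sum>i\<in>{1..m}. z i * h i x) > 0" for z
    unfolding g_def
  proof (rule det_pos_of_definite)
    show "hermitian (pencil C u {1..m} (cx z))" by (rule hermitian_pencil[OF C_herm]) (simp add: cx_def)
    fix x :: "complex^'n" assume "x \<noteq> 0"
    from that[OF this] show "0 < Re (hdot x (pencil C u {1..m} (cx z) *v x))"
      unfolding pencil_form C_form by (simp add: cx_def h_def)
  qed
  have base: "t * (norm x)\<^sup>2 \<le> R * ((norm x)\<^sup>2 - (\<Sum>i\<in>{1..m}. h i x)) + (\<Sum>i\<in>{1..m}. t * h i x)" for x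
  proof -
    have "t * ((norm x)\<^sup>2 - (\<Sum>i\<in>{1..m}. h i x)) \<le> R * ((norm x)\<^sup>2 - (\<Sum>i\<in>{1..m}. h i x))"
      using sub[of x] R(5) by (intro mult_right_mono) (auto simp: h_def)
    then show ?thesis by (simp add: algebra_simps sum_distrib_left)
  qed
  have g_above: "above_zeros g (\<lambda>_. t)"
    unfolding above_zeros_def
  proof (intro allI impI)
    fix z :: "nat \<Rightarrow> real" assume z: "(\<lambda>_. t) \<le> z"
    show "Re (g (cx z)) > 0"
    proof (rule g_pos)
      fix x :: "complex^'n" assume "x \<noteq> 0"
      then have "0 < t * (norm x)\<^sup>2" using R by simp
      also note base[of x]
      also have "(\<Sum>i\<in>{1..m}. t * h i x) \<le> (\<Sum>i\<in>{1..m}. z i * h i x)"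
        using z by (intro sum_mono mult_right_mono) (auto simp: h_def le_fun_def)
      finally show "0 < R * ((norm x)\<^sup>2 - (\<Sum>i\<in>{1..m}. h i x)) + (\<Sum>i\<in>{1..m}. z i * h i x)" by simp
    qed
  qed
  define \<alpha> where "\<alpha> = Re (g (cx (\<lambda>_. t)))"
  have \<alpha>: "\<alpha> > 0" unfolding \<alpha>_def by (rule above_zerosD[OF g_above order_refl])
  \<comment> \<open>This is \<open>u\<^sub>i\<^sup>* M\<^sup>-\<^sup>1 u\<^sub>i \<le> \<parallel>u\<^sub>i\<parallel>\<^sup>2 / t\<close> for \<open>M \<ge> t I\<close>, without inverses: the affine function
    of the coordinate \<open>i\<close> stays positive as long as that coordinate is lowered by less than
    \<open>t / \<parallel>u\<^sub>i\<parallel>\<^sup>2\<close>, so the lowering \<open>\<sigma>\<close> that makes it vanish is at least that large.\<close>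
  have slope: "t * Re (partial i g (cx (\<lambda>_. t))) \<le> \<alpha> * (norm (u i))\<^sup>2" if i: "i \<in> {1..m}" for i
  proof (rule ccontr)
    define \<beta> where "\<beta> = Re (partial i g (cx (\<lambda>_. t)))"
    assume "\<not> ?thesis"
    then have gt: "\<alpha> * (norm (u i))\<^sup>2 < t * \<beta>" by (simp add: \<beta>_def)
    then have \<beta>: "\<beta> > 0" using \<alpha> R
      by (meson le_less_trans less_imp_le mult_nonneg_nonneg zero_le_power2 zero_less_mult_pos)
    define \<sigma> where "\<sigma> = \<alpha> / \<beta>"
    have \<sigma>: "\<sigma> > 0" "\<sigma> * (norm (u i))\<^sup>2 < t" using \<alpha> \<beta> gt by (simp_all add: \<sigma>_def field_simps)
    have "0 < Re (g (cx ((\<lambda>_. t)(i := t + - \<sigma>))))"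
    proof (rule g_pos)
      fix x :: "complex^'n" assume x: "x \<noteq> 0"
      have "h i x \<le> (norm (u i) * norm x)\<^sup>2"
        unfolding h_def by (intro power_mono cmod_hdot_le) simp
      then have "\<sigma> * h i x \<le> \<sigma> * (norm (u i))\<^sup>2 * (norm x)\<^sup>2"
        using \<sigma>(1) by (simp add: power_mult_distrib mult.assoc)
      also have "\<dots> < t * (norm x)\<^sup>2" using \<sigma>(2) x by simp
      finally have "0 < t * (norm x)\<^sup>2 - \<sigma> * h i x" by simp
      moreover have "(\<Sum>j\<in>{1..m}. ((\<lambda>_. t)(i := t + - \<sigma>)) j * h j x) = (\<Sum>j\<in>{1..m}. t * h j x) - \<sigma> * h i x"
      proof -
        have "(\<Sum>j\<in>{1..m}. ((\<lambda>_. t)(i := t + - \<sigma>)) j * h j x)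
            = (\<Sum>j\<in>{1..m}. t * h j x - (if j = i then \<sigma> * h i x else 0))"
          by (intro sum.cong refl) (auto simp: algebra_simps)
        then show ?thesis using i by (simp add: sum_subtractf)
      qed
      ultimately show "0 < R * ((norm x)\<^sup>2 - (\<Sum>i\<in>{1..m}. h i x)) + (\<Sum>j\<in>{1..m}. ((\<lambda>_. t)(i := t + - \<sigma>)) j * h j x)"
        using base[of x] by linarith
    qed
    also have "Re (g (cx ((\<lambda>_. t)(i := t + - \<sigma>)))) = \<alpha> + - \<sigma> * \<beta>"
      using affine_step_cx[OF gm, of "\<lambda>_. t" i "- \<sigma>"] by (simp add: \<alpha>_def \<beta>_def)
    also have "\<dots> = 0" using \<beta> by (simp add: \<sigma>_def)
    finally show False by simp
  qed
  define P where "P = copies r g"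
  define K where "K = (\<lambda>i::nat. Pair i ` {1..r})"
  have P: "real_stable P" unfolding P_def by (rule real_stable_copies[OF g])
  have P_above: "above_zeros P (\<lambda>_. t)" unfolding P_def by (rule above_copies[OF gm g_above])
  have K: "finite (K i)" "card (K i) = r" "i \<noteq> j \<Longrightarrow> K i \<inter> K j = {}" for i j
    by (auto simp: K_def card_image inj_on_def)
  have bound: "Re (barrier (K i) P (cx (\<lambda>_. t))) \<le> 1 - 1 / s" for i
  proof -
    have ne: "g (cx (\<lambda>_. t)) \<noteq> 0" by (rule above_zeros_nonzero[OF g_above order_refl])
    have "barrier (K i) P (cx (\<lambda>_. t)) = of_nat r * barrier {i} g (cx (\<lambda>_. t))"
      unfolding K_def P_def barrier_copies[of g t, OF ne] by (simp add: barrier_def)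
    then have eq: "Re (barrier (K i) P (cx (\<lambda>_. t))) = r * (Re (partial i g (cx (\<lambda>_. t))) / \<alpha>)"
      by (simp add: Re_barrier_cx[OF gm] \<alpha>_def)
    have "r * (Re (partial i g (cx (\<lambda>_. t))) / \<alpha>) \<le> \<epsilon> / t"
    proof (cases "i \<in> {1..m}")
      case True
      have "t * (r * Re (partial i g (cx (\<lambda>_. t)))) \<le> r * (\<alpha> * (norm (u i))\<^sup>2)"
        using mult_left_mono[OF slope[OF True], of "real r"] by (simp add: mult_ac)
      also have "\<dots> \<le> \<alpha> * \<epsilon>"
        using mult_left_mono[OF small[OF True], of \<alpha>] \<alpha> by (simp add: mult_ac)
      finally show ?thesis using \<alpha> R by (simp add: field_simps)
    next
      case False
      have "pencil C u {1..m} ((cx (\<lambda>_. t))(i := x)) = pencil C u {1..m} (cx (\<lambda>_. t))" for x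
        unfolding pencil_def using False by (auto simp: vec_eq_iff intro!: sum.cong)
      then have "partial i g (cx (\<lambda>_. t)) = 0" by (simp add: partial_def g_def)
      then show ?thesis using \<epsilon> R by simp
    qed
    also have "\<epsilon> / t = 1 - 1 / s"
    proof -
      have "t = sqrt \<epsilon> * s" using sq by (simp add: t_def s_def power2_eq_square algebra_simps)
      then have "\<epsilon> / t = sqrt \<epsilon> / s" using sq R by (simp add: power2_eq_square[symmetric] field_simps)
      also have "\<dots> = 1 - 1 / s" using R by (simp add: s_def field_simps)
      finally show ?thesis .
    qed
    finally show ?thesis using eq by simp
  qed
  \<comment> \<open>Blocks are numbered from 0, so there are \<open>m + 1\<close> of them; \<open>g\<close> does not depend on the
    variable 0.\<close>
  have "above_zeros (iterated_minus_partials K (Suc m) P) (\<lambda>a. t + s * of_bool (a \<in> (\<Union>i<Suc m. K i)))"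
    by (rule above_iterated_minus_partials[OF P P_above K(1) R(4) K(3) bound])
  then have ab: "above_zeros (iterated_minus_partials K (Suc m) P) (\<lambda>_. R)"
    by (rule above_zeros_mono) (use R in \<open>auto simp: le_fun_def\<close>)
  have ev: "eventually_above P"
    unfolding eventually_above_def
  proof
    fix y :: "nat \<times> nat \<Rightarrow> real"
    have "above_zeros P (\<lambda>a. max t (y a))"
      by (rule above_zeros_mono[OF P_above]) (simp add: le_fun_def)
    then show "\<exists>x\<ge>y. above_zeros P x" by (auto simp: le_fun_def intro!: exI[of _ "\<lambda>a. max t (y a)"])
  qed
  have "\<exists>\<kappa>. (\<forall>i<Suc m. \<kappa> i \<in> K i) \<and>
      (\<forall>y\<ge>\<lambda>_. R. Re (P (cx (\<lambda>a. y a - real r * of_bool (a \<in> \<kappa> ` {..<Suc m})))) > 0)"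
    by (rule select_shifts[where K = K, OF P ev K(1) K(2) _ K(3) ab]) (use r in simp)
  then obtain \<kappa> where \<kappa>: "\<forall>i<Suc m. \<kappa> i \<in> K i"
    and pos: "\<forall>y\<ge>\<lambda>_. R. Re (P (cx (\<lambda>a. y a - real r * of_bool (a \<in> \<kappa> ` {..<Suc m})))) > 0"
    by blast
  define c where "c = (\<lambda>i. snd (\<kappa> i))"
  have \<kappa>c: "\<kappa> i = (i, c i)" "c i \<in> {1..r}" if "i < Suc m" for i
    using \<kappa> that by (auto simp: K_def c_def)
  have main: "inner x ((\<Sum>i | i \<in> {1..m} \<and> c i = k. outer_self (u i)) *v x) \<le> R / r * (norm x)\<^sup>2"
    if k: "k \<in> {1..r}" for k x
  proof -
    let ?S = "{i. i \<in> {1..m} \<and> c i = k}"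
    show ?thesis
    proof (rule form_le_of_nonsingular_ray[OF hermitian_sum_outer])
      show "R / r > 0" using R rp by simp
      fix \<theta> x assume \<theta>: "0 \<le> \<theta>" "\<theta> \<le> 1"
        and x: "(R / r) *\<^sub>R x = \<theta> *\<^sub>R ((\<Sum>i\<in>?S. outer_self (u i)) *v x)"
      \<comment> \<open>Undoing the fraction \<open>1 - \<theta>\<close> of the shift stays in the orthant above \<open>R\<close>, so the
        determinant is nonzero for every \<open>\<theta>\<close>.\<close>
      define y where "y = (\<lambda>a. R + (1 - \<theta>) * r * of_bool (a \<in> \<kappa> ` {..<Suc m}))"
      define z where "z = (\<lambda>i. R - \<theta> * r * of_bool ((i, k) \<in> \<kappa> ` {..<Suc m}))"
      have "(\<lambda>_. R) \<le> y" using \<theta> by (simp add: y_def le_fun_def)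
      then have "Re (P (cx (\<lambda>a. y a - real r * of_bool (a \<in> \<kappa> ` {..<Suc m})))) > 0" using pos by blast
      then have "(\<Prod>l\<in>{1..r}. Re (g (cx (\<lambda>i. y (i, l) - real r * of_bool ((i, l) \<in> \<kappa> ` {..<Suc m}))))) \<noteq> 0"
        unfolding P_def Re_copies_cx[OF gm] by (rule less_imp_neq[THEN not_sym])
      then have "Re (g (cx (\<lambda>i. y (i, k) - real r * of_bool ((i, k) \<in> \<kappa> ` {..<Suc m})))) \<noteq> 0"
        using k by (simp only: prod_zero_iff finite_atLeastAtMost) blast
      also have "(\<lambda>i. y (i, k) - real r * of_bool ((i, k) \<in> \<kappa> ` {..<Suc m})) = z"
        by (simp add: y_def z_def fun_eq_iff algebra_simps)
      finally have ne: "det (pencil C u {1..m} (cx z)) \<noteq> 0" unfolding g_def by auto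
      have z: "z i = R - \<theta> * r * of_bool (c i = k)" if "i \<in> {1..m}" for i
        using that \<kappa>c unfolding z_def by (force simp: image_iff)
      have "pencil C u {1..m} (cx z) *v x
          = of_real R *s x - of_real (\<theta> * r) *s (\<Sum>i\<in>{1..m}. (of_bool (c i = k) * hdot (u i) x) *s u i)"
      proof -
        have "(\<Sum>i\<in>{1..m}. (cx z i * hdot (u i) x) *s u i)
            = (\<Sum>i\<in>{1..m}. of_real R *s (hdot (u i) x *s u i)
                - of_real (\<theta> * r) *s ((of_bool (c i = k) * hdot (u i) x) *s u i))"
          by (intro sum.cong refl) (simp add: cx_def z vec_eq_iff algebra_simps)
        then show ?thesis
          by (simp add: pencil_mult C_mult vec_eq_iff sum_subtractf sum_distrib_left algebra_simps)
      qed
      also have "(\<Sum>i\<in>{1..m}. (of_bool (c i = k) * hdot (u i) x) *s u i)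
          = (\<Sum>i\<in>?S. outer_self (u i)) *v x"
        unfolding sum_matrix_mult outer_self_mult by (rule sum.mono_neutral_cong_right) auto
      also have "of_real R *s x - of_real (\<theta> * r) *s ((\<Sum>i\<in>?S. outer_self (u i)) *v x)
          = real r *\<^sub>R ((R / r) *\<^sub>R x - \<theta> *\<^sub>R ((\<Sum>i\<in>?S. outer_self (u i)) *v x))"
        unfolding scaleR_conv_smult vec_eq_iff vector_minus_component vector_smult_component
        using rp by (simp add: algebra_simps)
      also have "\<dots> = 0" unfolding x by simp
      finally show "x = 0" using ne det_nonzero_iff_kernel by blast
    qed
  qed
  have "\<forall>i\<in>{1..m}. c i \<in> {1..r}" using \<kappa>c(2) by auto
  then show ?thesis using main unfolding R_def by blast
qed

theorem corollary2:
  fixes r m :: nat and \<delta> :: real and u :: "nat \<Rightarrow> complex^'d"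
  assumes "r \<ge> 1" and "m \<ge> 1" and "\<delta> \<ge> 0"
    and "loewner_le (\<Sum>i\<in>{1..m}. outer_self (u i)) (mat 1)"
    and "\<And>i. i \<in> {1..m} \<Longrightarrow> (norm (u i))\<^sup>2 \<le> \<delta>"
  shows "\<exists>S :: nat \<Rightarrow> nat set.
           disjoint_family_on S {1..r} \<and> (\<Union>k\<in>{1..r}. S k) = {1..m} \<and>
           (\<forall>k\<in>{1..r}. spectral_norm (\<Sum>i\<in>S k. outer_self (u i))
                         \<le> 1 / real r * (1 + sqrt (real r * \<delta>))\<^sup>2)"
proof -
  have sub: "(\<Sum>i\<in>{1..m}. (cmod (hdot (u i) x))\<^sup>2) \<le> (norm x)\<^sup>2" for x
  proof -
    have "hdot x ((mat 1 - (\<Sum>i\<in>{1..m}. outer_self (u i))) *v x) \<in> \<real>\<^sub>\<ge>\<^sub>0"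
      using assms(4) unfolding loewner_le_def pos_semidef_def hdot_def by blast
    moreover have "hdot x ((mat 1 - (\<Sum>i\<in>{1..m}. outer_self (u i))) *v x)
        = hdot x x - hdot x ((\<Sum>i\<in>{1..m}. outer_self (u i)) *v x)"
      by (simp add: hdot_def matrix_vector_mult_diff_rdistrib right_diff_distrib sum_subtractf)
    moreover have "hdot x ((\<Sum>i\<in>{1..m}. outer_self (u i)) *v x) = of_real (\<Sum>i\<in>{1..m}. (cmod (hdot (u i) x))\<^sup>2)"
      unfolding hdot_sum_outer by (simp add: complex_norm_square mult.commute flip: of_real_power)
    ultimately have "complex_of_real ((norm x)\<^sup>2 - (\<Sum>i\<in>{1..m}. (cmod (hdot (u i) x))\<^sup>2)) \<in> \<real>\<^sub>\<ge>\<^sub>0"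
      by (simp add: hdot_self)
    then show ?thesis unfolding nonneg_Reals_of_real_iff by simp
  qed
  have "\<exists>c. (\<forall>i\<in>{1..m}. c i \<in> {1..r}) \<and> (\<forall>k\<in>{1..r}. \<forall>x.
    inner x ((\<Sum>i | i \<in> {1..m} \<and> c i = k. outer_self (u i)) *v x)
      \<le> (1 + sqrt (real r * \<delta>))\<^sup>2 / r * (norm x)\<^sup>2)"
  \<comment> \<open>For \<open>\<delta> = 0\<close> the starting point \<open>\<surd>\<epsilon> + \<epsilon>\<close> of the barrier argument would degenerate to 0, but
    then all \<open>u\<^sub>i\<close> vanish.\<close>
  proof (cases "\<delta> = 0")
    case False
    show ?thesis
      by (rule weaver_partition[OF assms(1) _ sub])
         (use False assms(1,3) assms(5) in \<open>simp_all add: mult_left_mono\<close>)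
  next
    case True
    then have "u i = 0" if "i \<in> {1..m}" for i using assms(5)[OF that] by simp
    then have "outer_self (u i) = 0" if "i \<in> {1..m}" for i
      using that by (simp add: outer_self_def vec_eq_iff)
    then have "(\<Sum>i | i \<in> {1..m} \<and> (\<lambda>_. 1) i = k. outer_self (u i)) = 0" for k :: nat
      by (intro sum.neutral) auto
    then show ?thesis using assms(1) by (intro exI[of _ "\<lambda>_. 1"]) auto
  qed
  then obtain c where c: "\<And>i. i \<in> {1..m} \<Longrightarrow> c i \<in> {1..r}" and form: "\<And>k x. k \<in> {1..r} \<Longrightarrow>
      inner x ((\<Sum>i | i \<in> {1..m} \<and> c i = k. outer_self (u i)) *v x)
        \<le> (1 + sqrt (real r * \<delta>))\<^sup>2 / r * (norm x)\<^sup>2" by blast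
  define S where "S = (\<lambda>k. {i. i \<in> {1..m} \<and> c i = k})"
  have "spectral_norm (\<Sum>i\<in>S k. outer_self (u i)) \<le> 1 / real r * (1 + sqrt (real r * \<delta>))\<^sup>2"
    if "k \<in> {1..r}" for k
    unfolding S_def by (rule spectral_norm_le_of_form) (use form[OF that] in simp_all)
  moreover have "disjoint_family_on S {1..r}" by (auto simp: disjoint_family_on_def S_def)
  moreover have "(\<Union>k\<in>{1..r}. S k) = {1..m}" using c by (auto simp: S_def)
  ultimately show ?thesis by blast
qed
end
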